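(* Let $D=\{x_1,\dots,x_d\}$ be a dictionary of strings over $[1..\sigma]$ of total length $n$, and consider the one-error approximate dictionary data structure built on $D$ (as described in the context). Assume that the hash function is fully random and incremental, and that each substitution list contains a single element (i.e. the $n$ keys $x_{i,j}$ are pairwise distinct). Then, for a query string of length $m$, the expected query time (reporting all dictionary words at edit distance at most $1$ from the query) is $O\!\left(m\left\lceil\frac{m\log\sigma}{w}\right\rceil\right)$, and the expected construction time is $O(n)$.
   Context: Edit distance: minimum number of unit-cost insertions, deletions and substitutions of single characters transforming one string into another. Model: word RAM with word length $w=\Omega(\log n)$. A hash function on strings is incremental if, after preprocessing a string $x$, the hash value of any string at edit distance one from $x$ (including strings where one position is replaced or a position is inserted as a wildcard) can be computed in constant time. A hash function from $U$ to $V$ is fully random if it behaves as a function chosen uniformly at random among all functions $U\to V$. Fixed constants: load factor $0<\alpha<1$, signature length $r=O(1)$. Linear probing hash table with $t$ slots: an element with hash value $h$ is inserted at the first empty slot among $h\bmod t,(h+1)\bmod t,\dots$; a lookup scans from $h\bmod t$ until an empty slot. Tables storing $k$ items have $\lceil k/\alpha\rceil$ slots. Data structure: (1) exact dictionary: words of $D$ grouped by length, each group in a linear probing hash table keyed by the word; (2) substitution store: one linear probing table in which, for every word $x_i$ of length $n_i$ and every $j\in[1..n_i]$, the character $x_i[j]$ with an $r$-bit signature derived from the hash of $x_{i,j}=x_i[1..j-1]\phi x_i[j+1..n_i]$ ($\phi$ a wildcard) is inserted starting at position $h(x_{i,j})\bmod t$; the characters inserted under a common key form a substitution list. Query for $x$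 of length $m$: for each way of placing a wildcard at a position of $x$ (substitution) or inserting a wildcard into $x$ (insertion), the substitution store is scanned from the key's hash position until an empty slot, collecting characters whose signature matches; each collected character yields a candidate string; additionally every string obtained from $x$ by deleting one character, and $x$ itself, are candidates; each candidate is looked up in the exact dictionary, comparing strings word-parallel in $O(\lceil m\log\sigma/w\rceil)$ time per comparison.
   Formalization: The range V is assumed to make h mod t hit each slot with probability at most (1+δ)/t, α(1+δ)<1 (the claim fails e.g. for |V|=1); hash preprocessing of a string is taken to cost linear time; σ≥2, m≥1 and n≥1 are assumed, as the bounds are otherwise 0. *)

theory Defs
  imports "HOL-Probability.Probability"
begin

section \<open>Strings, wildcards and edit distance\<close>

text \<open>
  The alphabet is \<open>{1..\<sigma>}\<close>.  The wildcard is the letter \<open>0\<close>, which lies outside every alphabet, so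
  that words and keys have the same type.  Positions are counted from 0.
\<close>

type_synonym str = "nat list"

abbreviation (input) wildcard :: nat ("\<phi>") where "\<phi> \<equiv> 0"

datatype 'a edit = Ins nat 'a | Del nat | Sub nat 'a

fun valid_edit :: "'a edit \<Rightarrow> 'a list \<Rightarrow> bool" where
  "valid_edit (Ins j a) x \<longleftrightarrow> j \<le> length x"
| "valid_edit (Del j) x \<longleftrightarrow> j < length x"
| "valid_edit (Sub j a) x \<longleftrightarrow> j < length x"

fun apply_edit :: "'a edit \<Rightarrow> 'a list \<Rightarrow> 'a list" where
  "apply_edit (Ins j a) x = take j x @ a # drop j x"
| "apply_edit (Del j) x = take j x @ drop (Suc j) x"
| "apply_edit (Sub j a) x = take j x @ a # drop (Suc j) x"

definition edit_step :: "'a list \<Rightarrow> 'a list \<Rightarrow> bool" where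
  "edit_step x y \<longleftrightarrow> (\<exists>e. valid_edit e x \<and> y = apply_edit e x)"

definition edit_distance :: "'a list \<Rightarrow> 'a list \<Rightarrow> nat" where
  "edit_distance x y = (LEAST k. (edit_step ^^ k) x y)"

definition total_length :: "str list \<Rightarrow> nat" where
  "total_length D = sum_list (map length D)"

definition subst_key :: "str \<Rightarrow> nat \<Rightarrow> str" where
  "subst_key x j = apply_edit (Sub j \<phi>) x"


section \<open>Computations with a step count\<close>

text \<open>
  A computation is its result together with the number of word RAM steps it takes.  Letters, positions,
  hash values and signatures are handled as single machine words.
\<close>

type_synonym 'a timed = "'a \<times> nat"

abbreviation result :: "'a timed \<Rightarrow> 'a" where "result \<equiv> fst"
abbreviation time :: "'a timed \<Rightarrow> nat" where "time \<equiv> snd"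

definition return_timed :: "'a \<Rightarrow> 'a timed" where
  "return_timed a = (a, 0)"

definition tick :: "nat \<Rightarrow> unit timed" where
  "tick k = ((), k)"

definition bind_timed :: "'a timed \<Rightarrow> ('a \<Rightarrow> 'b timed) \<Rightarrow> 'b timed" where
  "bind_timed m f = (result (f (result m)), time m + time (f (result m)))"

adhoc_overloading Monad_Syntax.bind \<rightleftharpoons> bind_timed

primrec map_timed :: "('a \<Rightarrow> 'b timed) \<Rightarrow> 'a list \<Rightarrow> 'b list timed" where
  "map_timed f [] = return_timed []"
| "map_timed f (a # as) = do {
     tick 1;
     b \<leftarrow> f a;
     bs \<leftarrow> map_timed f as;
     return_timed (b # bs)
   }"

text \<open>
  The number of machine words of \<open>w\<close> bits occupied by a packed string of length \<open>k\<close>.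
\<close>

definition packed_words :: "nat \<Rightarrow> nat \<Rightarrow> nat \<Rightarrow> nat" where
  "packed_words \<sigma> w k = nat \<lceil>real k * log 2 (real \<sigma>) / real w\<rceil>"


section \<open>Hash functions\<close>

text \<open>
  The strings that may have to be hashed: wildcards are allowed, and the length is bounded by \<open>L\<close> so that
  the universe is finite.  A fully random hash function is uniformly distributed over all functions from
  this universe to \<open>V\<close>.
\<close>

definition universe :: "nat \<Rightarrow> nat \<Rightarrow> str set" where
  "universe \<sigma> L = {y. set y \<subseteq> insert \<phi> {1..\<sigma>} \<and> length y \<le> L}"

definition hash_functions :: "nat \<Rightarrow> nat \<Rightarrow> nat set \<Rightarrow> (str \<Rightarrow> nat) set" where
  "hash_functions \<sigma> L V = universe \<sigma> L \<rightarrow>\<^sub>E V"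

definition random_hash :: "nat \<Rightarrow> nat \<Rightarrow> nat set \<Rightarrow> (str \<Rightarrow> nat) pmf" where
  "random_hash \<sigma> L V = pmf_of_set (hash_functions \<sigma> L V)"

text \<open>
  Hash values are used modulo the size \<open>t\<close> of a table.  Even a fully random hash value need not be spread
  uniformly over the slots, since \<open>t\<close> need not divide the number of hash values.  The following condition
  says that no slot is hit with probability more than \<open>(1 + \<delta>) / t\<close>.
\<close>

definition near_uniform :: "real \<Rightarrow> nat set \<Rightarrow> nat \<Rightarrow> bool" where
  "near_uniform \<delta> V t \<longleftrightarrow>
     (\<forall>s<t. real t * real (card {v \<in> V. v mod t = s}) \<le> (1 + \<delta>) * real (card V))"

text \<open>
  Two typical cases: the hash values are the numbers below \<open>M\<close>, and \<open>t\<close> divides \<open>M\<close>, or \<open>M\<close> is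
  sufficiently large compared with \<open>t\<close>.
\<close>

lemma card_residue_le: "card {v \<in> {..<M}. v mod t = s} \<le> (M + t - 1) div t" if "0 < t" for M s t :: nat
proof -
  have "inj_on (\<lambda>v. v div t) {v \<in> {..<M}. v mod t = s}"
  proof (rule inj_onI)
    fix a b assume "a \<in> {v \<in> {..<M}. v mod t = s}" "b \<in> {v \<in> {..<M}. v mod t = s}" "a div t = b div t"
    then show "a = b"
      using div_mult_mod_eq[of a t] div_mult_mod_eq[of b t] by simp
  qed
  moreover have "(\<lambda>v. v div t) ` {v \<in> {..<M}. v mod t = s} \<subseteq> {..<(M + t - 1) div t}"
  proof clarsimp
    fix v assume "v < M"
    have "v div t * t \<le> v"
      by simp
    then have "(v div t + 1) * t \<le> M + t - 1"
      using \<open>v < M\<close> that by (simp only: distrib_right)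
    then have "v div t + 1 \<le> (M + t - 1) div t"
      using that by (simp add: less_eq_div_iff_mult_less_eq)
    then show "v div t < (M + t - Suc 0) div t"
      by simp
  qed
  ultimately show ?thesis
    using card_inj_on_le[of _ _ "{..<(M + t - 1) div t}"] by simp
qed

lemma near_uniform_dvd: "near_uniform 0 {..<M} t" if "t dvd M"
proof -
  have "t * card {v \<in> {..<M}. v mod t = s} \<le> M" if "s < t" for s
  proof -
    obtain q where "M = t * q"
      using \<open>t dvd M\<close> by blast
    moreover have "(t * q + t - 1) div t = q"
      using \<open>s < t\<close> by (simp add: div_nat_eqI)
    ultimately show ?thesis
      using card_residue_le[of t M s] \<open>s < t\<close> by simp
  qed
  then show ?thesis
    unfolding near_uniform_def by (simp flip: of_nat_mult)
qed

lemma near_uniform_large: "near_uniform \<delta> {..<M} t" if "real t \<le> \<delta> * real M"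
  unfolding near_uniform_def
proof (intro allI impI)
  fix s assume "s < t"
  have "t * card {v \<in> {..<M}. v mod t = s} \<le> t * ((M + t - 1) div t)"
    using card_residue_le[of t M s] \<open>s < t\<close> by simp
  also have "\<dots> \<le> M + t"
    using times_div_less_eq_dividend[of t "M + t - 1"] by linarith
  finally have "real (t * card {v \<in> {..<M}. v mod t = s}) \<le> real (M + t)"
    by (rule of_nat_mono)
  then show "real t * real (card {v \<in> {..<M}. v mod t = s}) \<le> (1 + \<delta>) * real (card {..<M})"
    using that by (simp add: algebra_simps)
qed

text \<open>
  An implementation of a hash function.  Preprocessing a string \<open>x\<close> yields the hash value of \<open>x\<close> and an
  evaluator, which computes from an edit operation the hash value of the edited string.
\<close>

type_synonym hasher = "str \<Rightarrow> (nat \<times> (nat edit \<Rightarrow> nat timed)) timed"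

definition incremental :: "nat \<Rightarrow> nat \<Rightarrow> nat \<Rightarrow> (str \<Rightarrow> nat) \<Rightarrow> hasher \<Rightarrow> bool" where
  "incremental c \<sigma> L h prep \<longleftrightarrow>
     (\<forall>x. set x \<subseteq> {1..\<sigma>} \<and> length x \<le> L \<longrightarrow>
        time (prep x) \<le> c * (length x + 1) \<and>
        (case result (prep x) of (v, hev) \<Rightarrow>
           v = h x \<and>
           (\<forall>e. valid_edit e x \<and> apply_edit e x \<in> universe \<sigma> L \<longrightarrow>
              result (hev e) = h (apply_edit e x) \<and> time (hev e) \<le> c)))"


section \<open>Linear probing\<close>

type_synonym 'e hash_table = "'e option list"

definition num_slots :: "real \<Rightarrow> nat \<Rightarrow> nat" where
  "num_slots \<alpha> k = nat \<lceil>real k / \<alpha>\<rceil>"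

definition empty_table :: "nat \<Rightarrow> 'e hash_table timed" where
  "empty_table t = (replicate t None, 1 + t)"

text \<open>
  The number of occupied slots met from hash value \<open>v\<close> on before the first empty one.
\<close>

definition run_length :: "'e hash_table \<Rightarrow> nat \<Rightarrow> nat" where
  "run_length T v = (LEAST k. T ! ((v + k) mod length T) = None)"

definition insert_table :: "nat \<Rightarrow> 'e \<Rightarrow> 'e hash_table \<Rightarrow> 'e hash_table timed" where
  "insert_table v e T = (T[(v + run_length T v) mod length T := Some e], run_length T v + 1)"

text \<open>
  The table for an empty collection has no slots at all, so a scan of it ends at once.
\<close>

definition scan_table :: "nat \<Rightarrow> 'e hash_table \<Rightarrow> 'e list timed" where
  "scan_table v T =
     (if T = [] then ([], 1)
      else (map (\<lambda>k. the (T ! ((v + k) mod length T))) [0..<run_length T v], run_length T v + 1))"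

primrec insert_all :: "(nat \<times> 'e) list \<Rightarrow> 'e hash_table \<Rightarrow> 'e hash_table timed" where
  "insert_all [] T = return_timed T"
| "insert_all (p # ps) T = do {
     T' \<leftarrow> insert_table (fst p) (snd p) T;
     insert_all ps T'
   }"

definition build_table :: "real \<Rightarrow> (nat \<times> 'e) list \<Rightarrow> 'e hash_table timed" where
  "build_table \<alpha> ps = do {
     T \<leftarrow> empty_table (num_slots \<alpha> (length ps));
     insert_all ps T
   }"


section \<open>The data structure\<close>

text \<open>
  The first component is the substitution store, whose entries are pairs of a letter and a signature.
  The second one is the exact dictionary, an array of tables indexed by the length of the words.
\<close>

type_synonym dictionary = "(nat \<times> nat) hash_table \<times> str hash_table list"

definition max_length :: "str list \<Rightarrow> nat" where
  "max_length D = foldr max (map length D) 0"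

text \<open>
  Hashes a word and its substitution keys; \<open>sig\<close> maps a hash value to its signature.
\<close>

definition hash_word ::
  "(nat \<Rightarrow> nat) \<Rightarrow> hasher \<Rightarrow> str \<Rightarrow> ((nat \<times> str) \<times> (nat \<times> nat \<times> nat) list) timed" where
  "hash_word sig prep x = do {
     tick (1 + length x);
     (v, hev) \<leftarrow> prep x;
     items \<leftarrow> map_timed (\<lambda>j. do {
         u \<leftarrow> hev (Sub j \<phi>);
         return_timed (u, x ! j, sig u)
       }) [0..<length x];
     return_timed ((v, x), items)
   }"

text \<open>
  The second \<open>tick\<close> pays for counting the keys and for distributing the words by length.
\<close>

definition build :: "real \<Rightarrow> (nat \<Rightarrow> nat) \<Rightarrow> hasher \<Rightarrow> str list \<Rightarrow> dictionary timed" where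
  "build \<alpha> sig prep D = do {
     hashed \<leftarrow> map_timed (hash_word sig prep) D;
     tick (1 + length D + total_length D + max_length D);
     store \<leftarrow> build_table \<alpha> (concat (map snd hashed));
     exact \<leftarrow> map_timed
       (\<lambda>l. build_table \<alpha> (filter (\<lambda>p. length (snd p) = l) (map fst hashed)))
       [0..<Suc (max_length D)];
     return_timed (store, exact)
   }"

text \<open>
  The sizes of the tables that \<open>build\<close> creates.
\<close>

definition table_sizes :: "real \<Rightarrow> str list \<Rightarrow> nat set" where
  "table_sizes \<alpha> D =
     insert (num_slots \<alpha> (total_length D))
       (range (\<lambda>l. num_slots \<alpha> (length (filter (\<lambda>x. length x = l) D))))"


section \<open>Queries\<close>

text \<open>
  Looks up the candidate \<open>y\<close> with hash value \<open>v\<close> in the exact dictionary, and returns \<open>[y]\<close> or \<open>[]\<close>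
  according to whether it is present.  Writing down the packed candidate and each comparison with a
  stored word of the same length take \<open>1 + packed_words \<sigma> w (length y)\<close> steps.
\<close>

definition check ::
  "nat \<Rightarrow> nat \<Rightarrow> str hash_table list \<Rightarrow> nat \<Rightarrow> str \<Rightarrow> str list timed" where
  "check \<sigma> w exact v y = do {
     tick (1 + packed_words \<sigma> w (length y));
     if length y < length exact
     then do {
       ys \<leftarrow> scan_table v (exact ! length y);
       found \<leftarrow> map_timed (\<lambda>y'. do {
           tick (1 + packed_words \<sigma> w (length y));
           return_timed (y' = y)
         }) ys;
       return_timed (if True \<in> set found then [y] else [])
     }
     else return_timed []
   }"

definition try_edit ::
  "nat \<Rightarrow> nat \<Rightarrow> str hash_table list \<Rightarrow> str \<Rightarrow> (nat edit \<Rightarrow> nat timed) \<Rightarrow> nat edit \<Rightarrow>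
   str list timed" where
  "try_edit \<sigma> w exact x hev e = do {
     v \<leftarrow> hev e;
     check \<sigma> w exact v (apply_edit e x)
   }"

text \<open>
  Here \<open>E\<close> is \<open>Sub j\<close> or \<open>Ins j\<close>: the edit \<open>E \<phi>\<close> places the wildcard, and \<open>E a\<close> the collected letter \<open>a\<close>
  instead of it.
\<close>

definition try_wildcard ::
  "nat \<Rightarrow> nat \<Rightarrow> (nat \<Rightarrow> nat) \<Rightarrow> dictionary \<Rightarrow> str \<Rightarrow> (nat edit \<Rightarrow> nat timed) \<Rightarrow>
   (nat \<Rightarrow> nat edit) \<Rightarrow> str list timed" where
  "try_wildcard \<sigma> w sig I x hev E = do {
     u \<leftarrow> hev (E \<phi>);
     entries \<leftarrow> scan_table u (fst I);
     yss \<leftarrow> map_timed (\<lambda>(a, s).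
         if s = sig u then try_edit \<sigma> w (snd I) x hev (E a) else return_timed []) entries;
     return_timed (concat yss)
   }"

definition query ::
  "nat \<Rightarrow> nat \<Rightarrow> (nat \<Rightarrow> nat) \<Rightarrow> hasher \<Rightarrow> dictionary \<Rightarrow> str \<Rightarrow> str list timed" where
  "query \<sigma> w sig prep I x = do {
     tick (1 + length x);
     (v, hev) \<leftarrow> prep x;
     same \<leftarrow> check \<sigma> w (snd I) v x;
     dels \<leftarrow> map_timed (\<lambda>j. try_edit \<sigma> w (snd I) x hev (Del j)) [0..<length x];
     subs \<leftarrow> map_timed (\<lambda>j. try_wildcard \<sigma> w sig I x hev (Sub j)) [0..<length x];
     inss \<leftarrow> map_timed (\<lambda>j. try_wildcard \<sigma> w sig I x hev (Ins j)) [0..<Suc (length x)];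
     return_timed (same @ concat dels @ concat subs @ concat inss)
   }"

end

theory Submission
  imports Defs
begin

text \<open>
  A run of occupied slots, extended backwards to the preceding empty slot, is an interval of slots into
  which at least as many keys were hashed as it has slots.  With load \<open>\<beta> = \<alpha> (1 + \<delta>) < 1\<close>, a Chernoff bound
  with base \<open>z = 1 / \<beta>\<close> shows that this happens for an interval of length \<open>k\<close> with probability at most
  \<open>z (\<beta> exp (1 - \<beta>)) ^ k\<close>; the factor \<open>z\<close> accounts for the case that the key looked up is itself stored.
  Summing two geometric series bounds the expected run length by a constant, which gives the construction
  time.  For a query, the letters collected from the substitution store depend only on the hash values of
  strings with a wildcard, whereas the lookups in the exact dictionary depend only on those of strings
  without one.  By independence, the expected number of comparisons for one wildcard is at most the
  product of two such constants.
\<close>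

section \<open>Timed computations\<close>

text \<open>No event probabilities are formed. A run of length R is counted as the number of l with
  1 \<le> l \<le> R. For each such l some backward extension d gives an interval of d + l slots with
  at least d + l hits, and the Markov step \<open>1 \<le> z ^ hits / z ^ (d + l)\<close> is taken
  for each hash function separately. What remains is a finite sum of products over the keys, and the
  mean of such a product is governed by independence. The choice z = 1 / \<beta> minimises exp ((z -
  1) \<beta>) / z; the minimum is the rate \<beta> exp (1 - \<beta>), which is below 1 whenever 0 <
  \<beta> < 1.

  Two dependencies stand in the way. The interval is located relative to the hash value of the
  string looked up, so the factor of that string is taken out of the product and the mean is split
  according to this hash value. In a query, moreover, both the number of candidates and the
  candidates themselves are random. Their costs can still be averaged separately, because the
  wildcard is not a letter and so no key coincides with a dictionary word or a candidate.\<close>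

lemma result_bind [simp]: "result (bind_timed m f) = result (f (result m))"
  and time_bind [simp]: "time (bind_timed m f) = time m + time (f (result m))"
  by (simp_all add: bind_timed_def)

lemma result_return [simp]: "result (return_timed a) = a"
  and time_return [simp]: "time (return_timed a) = 0"
  by (simp_all add: return_timed_def)

lemma time_tick [simp]: "time (tick k) = k"
  by (simp add: tick_def)

lemma result_map_timed [simp]: "result (map_timed f xs) = map (\<lambda>x. result (f x)) xs"
  by (induction xs) simp_all

lemma time_map_timed [simp]: "time (map_timed f xs) = (\<Sum>x\<leftarrow>xs. 1 + time (f x))"
  by (induction xs) simp_all


section \<open>Linear probing\<close>

definition fill :: "nat \<Rightarrow> (nat \<times> 'e) list \<Rightarrow> 'e hash_table" where
  "fill t ps = result (insert_all ps (replicate t None))"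

text \<open>The invariant of linear probing. \<open>pos i\<close> is the slot that received the i-th
  pair; the order of insertions is forgotten, and all that is kept of a probe sequence is that it
  crosses no empty slot.\<close>

definition linear_probed :: "(nat \<times> 'e) list \<Rightarrow> 'e hash_table \<Rightarrow> bool" where
  "linear_probed ps T \<longleftrightarrow>
     (\<exists>pos. inj_on pos {..<length ps} \<and> {s. s < length T \<and> T ! s \<noteq> None} = pos ` {..<length ps} \<and>
       (\<forall>i<length ps. T ! pos i = Some (snd (ps ! i)) \<and>
          (\<exists>k. pos i = (fst (ps ! i) + k) mod length T \<and>
               (\<forall>k'<k. T ! ((fst (ps ! i) + k') mod length T) \<noteq> None))))"

lemma linear_probedE:
  assumes "linear_probed ps T"
  obtains pos where "inj_on pos {..<length ps}"
    and "{s. s < length T \<and> T ! s \<noteq> None} = pos ` {..<length ps}"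
    and "\<forall>i<length ps. T ! pos i = Some (snd (ps ! i))"
    and "\<forall>i<length ps. \<exists>k. pos i = (fst (ps ! i) + k) mod length T \<and>
               (\<forall>k'<k. T ! ((fst (ps ! i) + k') mod length T) \<noteq> None)"
proof -
  from assms obtain pos where "inj_on pos {..<length ps} \<and>
      {s. s < length T \<and> T ! s \<noteq> None} = pos ` {..<length ps} \<and>
       (\<forall>i<length ps. T ! pos i = Some (snd (ps ! i)) \<and>
          (\<exists>k. pos i = (fst (ps ! i) + k) mod length T \<and>
               (\<forall>k'<k. T ! ((fst (ps ! i) + k') mod length T) \<noteq> None)))"
    unfolding linear_probed_def ..
  then show thesis
    by (intro that[of pos]) simp_all
qed

lemma insert_all_append:
  "insert_all (ps @ qs) T = bind_timed (insert_all ps T) (insert_all qs)"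
  by (induction ps arbitrary: T) (simp_all add: bind_timed_def return_timed_def)

lemma fill_Nil [simp]: "fill t [] = replicate t None"
  by (simp add: fill_def)

lemma fill_snoc: "fill t (ps @ [p]) = result (insert_table (fst p) (snd p) (fill t ps))"
  by (simp add: fill_def insert_all_append)

lemma length_fill [simp]: "length (fill t ps) = t"
  by (induction ps rule: rev_induct) (simp_all add: fill_snoc insert_table_def)

lemma time_insert_all:
  "time (insert_all ps (replicate t None)) =
     (\<Sum>i<length ps. run_length (fill t (take i ps)) (fst (ps ! i)) + 1)"
proof (induction ps rule: rev_induct)
  case (snoc p ps)
  have "(\<Sum>i<length ps. run_length (fill t (take i (ps @ [p]))) (fst ((ps @ [p]) ! i)) + 1)
      = (\<Sum>i<length ps. run_length (fill t (take i ps)) (fst (ps ! i)) + 1)"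
    by (intro sum.cong) (simp_all add: nth_append)
  then show ?case
    using snoc by (simp add: insert_all_append insert_table_def fill_def)
qed simp

section \<open>Empty slots and the probing invariant\<close>

lemma exists_empty_slot:
  assumes "linear_probed ps T" and "length ps < length T"
  shows "\<exists>s<length T. T ! s = None"
proof (rule ccontr)
  assume "\<not> ?thesis"
  then have "{s. s < length T \<and> T ! s \<noteq> None} = {..<length T}"
    by auto
  then have "card {..<length T} = card {..<length ps}"
    using assms(1) unfolding linear_probed_def by (metis card_image)
  then show False
    using assms(2) by simp
qed

lemma nat_mod_add_cancel: "a mod t = b mod t" if "(a + c) mod t = (b + c) mod t" for a b c t :: nat
proof -
  obtain p q where "a + c + t * p = b + c + t * q"
    using \<open>(a + c) mod t = (b + c) mod t\<close> unfolding nat_mod_eq_iff by blast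
  then have "a + t * p = b + t * q"
    by simp
  then show ?thesis
    unfolding nat_mod_eq_iff by blast
qed

lemma mod_reachable: "\<exists>k<t. (v + k) mod t = s" if "s < t" for v s t :: nat
proof -
  have "(v + (s + (t - v mod t)) mod t) mod t = (v mod t + (s + (t - v mod t))) mod t"
    by (simp add: mod_simps)
  also have "v mod t + (s + (t - v mod t)) = s + t"
    using that mod_less_divisor[of t v] by linarith
  also have "(s + t) mod t = s"
    using that by simp
  finally show ?thesis
    using that by (intro exI[of _ "(s + (t - v mod t)) mod t"]) simp
qed

text \<open>The \<open>LEAST\<close> in \<open>run_length\<close> is meaningful only if some slot is
  empty. A single one suffices, wherever it is, since a probe sequence visits every slot within
  \<open>length T\<close> steps.\<close>

lemma run_length_properties:
  assumes "s < length T" and "T ! s = None"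
  shows run_length_empty: "T ! ((v + run_length T v) mod length T) = None"
    and run_length_occupied: "\<And>k. k < run_length T v \<Longrightarrow> T ! ((v + k) mod length T) \<noteq> None"
    and run_length_less: "run_length T v < length T"
proof -
  obtain k where k: "k < length T" "(v + k) mod length T = s"
    using mod_reachable[OF assms(1)] by blast
  then have *: "T ! ((v + k) mod length T) = None"
    using assms by simp
  show "T ! ((v + run_length T v) mod length T) = None"
    unfolding run_length_def by (rule LeastI) (rule *)
  show "\<And>k. k < run_length T v \<Longrightarrow> T ! ((v + k) mod length T) \<noteq> None"
    unfolding run_length_def by (rule not_less_Least)
  show "run_length T v < length T"
    using k(1) Least_le[of "\<lambda>k. T ! ((v + k) mod length T) = None", OF *]
    unfolding run_length_def by linarith
qed

text \<open>An insertion only turns an empty slot into an occupied one, so the probe sequences of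
  the earlier entries stay free of empty slots; that of the new entry is the run just
  scanned.\<close>

lemma linear_probed_insert:
  assumes "linear_probed ps T" and "length ps < length T"
  shows "linear_probed (ps @ [p]) (result (insert_table (fst p) (snd p) T))"
proof -
  obtain s where s: "s < length T" "T ! s = None"
    using exists_empty_slot[OF assms] by blast
  obtain pos where inj: "inj_on pos {..<length ps}"
    and occ: "{s. s < length T \<and> T ! s \<noteq> None} = pos ` {..<length ps}"
    and entry: "\<forall>i<length ps. T ! pos i = Some (snd (ps ! i))"
    and path: "\<forall>i<length ps. \<exists>k. pos i = (fst (ps ! i) + k) mod length T \<and>
               (\<forall>k'<k. T ! ((fst (ps ! i) + k') mod length T) \<noteq> None)"
    by (rule linear_probedE[OF assms(1)])
  define n where "n = (fst p + run_length T (fst p)) mod length T"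
  have n: "n < length T" "T ! n = None"
    using s run_length_empty[OF s] by (auto simp: n_def intro: mod_less_divisor)
  define T' where "T' = T[n := Some (snd p)]"
  have T': "T' ! m = (if m = n then Some (snd p) else T ! m)" if "m < length T" for m
    using that by (simp add: T'_def)
  have [simp]: "length T' = length T"
    by (simp add: T'_def)
  define pos' where "pos' = pos(length ps := n)"
  have fresh: "n \<notin> pos ` {..<length ps}"
    using n unfolding occ[symmetric] by simp
  have range: "pos i < length T" if "i < length ps" for i
    using that occ by blast
  have mod: "x mod length T < length T" for x
    using s(1) by (intro mod_less_divisor) linarith
  have "linear_probed (ps @ [p]) T'"
    unfolding linear_probed_def
  proof (intro exI[of _ pos'] conjI allI impI)
    have "inj_on pos' {..<length ps}"
      using inj by (rule inj_on_cong[THEN iffD1, rotated]) (simp add: pos'_def)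
    moreover have img: "pos' ` {..<length ps} = pos ` {..<length ps}"
      by (intro image_cong) (simp_all add: pos'_def)
    ultimately show "inj_on pos' {..<length (ps @ [p])}"
      using fresh by (simp add: lessThan_Suc pos'_def)
    have "{s. s < length T' \<and> T' ! s \<noteq> None} = insert n {s. s < length T \<and> T ! s \<noteq> None}"
      using n by (auto simp: T')
    then show "{s. s < length T' \<and> T' ! s \<noteq> None} = pos' ` {..<length (ps @ [p])}"
      using img unfolding occ by (simp add: lessThan_Suc) (simp add: pos'_def)
  next
    fix i assume i: "i < length (ps @ [p])"
    show "T' ! pos' i = Some (snd ((ps @ [p]) ! i))"
    proof (cases "i = length ps")
      case False
      then have "i < length ps" using i by simp
      moreover have "pos i \<noteq> n"
        using fresh \<open>i < length ps\<close> by blast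
      ultimately show ?thesis
        using entry[rule_format, of i] by (simp add: T' range pos'_def nth_append)
    qed (simp add: pos'_def T' n)
    show "\<exists>k. pos' i = (fst ((ps @ [p]) ! i) + k) mod length T' \<and>
             (\<forall>k'<k. T' ! ((fst ((ps @ [p]) ! i) + k') mod length T') \<noteq> None)"
    proof (cases "i = length ps")
      case True
      then show ?thesis
        using run_length_occupied[OF s, of _ "fst p"]
        by (intro exI[of _ "run_length T (fst p)"]) (auto simp: pos'_def n_def[symmetric] T' mod)
    next
      case False
      then have i': "i < length ps" using i by simp
      then obtain k where "pos i = (fst (ps ! i) + k) mod length T"
         "\<forall>k'<k. T ! ((fst (ps ! i) + k') mod length T) \<noteq> None"
        using path by blast
      then show ?thesis
        using i' by (intro exI[of _ k]) (simp add: pos'_def nth_append T' mod)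
    qed
  qed
  then show ?thesis
    by (simp add: insert_table_def T'_def n_def)
qed

lemma linear_probed_fill: "length ps \<le> t \<Longrightarrow> linear_probed ps (fill t ps)"
proof (induction ps rule: rev_induct)
  case Nil
  then show ?case
    by (auto simp: linear_probed_def)
next
  case (snoc p ps)
  then show ?case
    by (simp add: fill_snoc linear_probed_insert)
qed

text \<open>An entry stored under v is met before the run from v ends: an empty slot reached earlier
  would lie on its probe sequence, and its own slot is occupied.\<close>

lemma scan_fill:
  assumes "length ps < t"
  shows length_scan_fill: "length (result (scan_table v (fill t ps))) = run_length (fill t ps) v"
    and scan_fill_complete: "(v, e) \<in> set ps \<Longrightarrow> e \<in> set (result (scan_table v (fill t ps)))"
    and scan_fill_sound: "set (result (scan_table v (fill t ps))) \<subseteq> snd ` set ps"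
proof -
  let ?T = "fill t ps"
  have lp: "linear_probed ps ?T"
    using assms by (simp add: linear_probed_fill)
  obtain pos where "inj_on pos {..<length ps}" and occ: "{s. s < length ?T \<and> ?T ! s \<noteq> None} = pos ` {..<length ps}"
    and entry: "\<forall>i<length ps. ?T ! pos i = Some (snd (ps ! i))"
    and path: "\<forall>i<length ps. \<exists>k. pos i = (fst (ps ! i) + k) mod length ?T \<and>
               (\<forall>k'<k. ?T ! ((fst (ps ! i) + k') mod length ?T) \<noteq> None)"
    by (rule linear_probedE[OF lp])
  obtain s where s: "s < length ?T" "?T ! s = None"
    using exists_empty_slot[OF lp] assms by auto
  have ne: "?T \<noteq> []"
    using assms by (metis length_fill list.size(3) not_less_zero)
  show "length (result (scan_table v ?T)) = run_length ?T v"
    using ne by (simp add: scan_table_def)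
  have scan: "set (result (scan_table v ?T)) = (\<lambda>k. the (?T ! ((v + k) mod t))) ` {..<run_length ?T v}"
    using ne by (simp add: scan_table_def atLeast_upt)
  show "e \<in> set (result (scan_table v ?T))" if mem: "(v, e) \<in> set ps"
  proof -
    obtain i where i: "i < length ps" "ps ! i = (v, e)"
      using mem unfolding in_set_conv_nth by blast
    then obtain k where k: "pos i = (v + k) mod t"
      "\<forall>k'<k. ?T ! ((v + k') mod t) \<noteq> None"
      using path[rule_format, of i] by auto
    have "?T ! ((v + k) mod t) = Some e"
      using entry[rule_format, of i] i k by simp
    moreover have "k < run_length ?T v"
    proof (rule ccontr)
      assume "\<not> k < run_length ?T v"
      then consider "run_length ?T v < k" | "run_length ?T v = k"
        by linarith
      then show False
        using k(2)[rule_format, of "run_length ?T v"] run_length_empty[OF s, of v] \<open>?T ! ((v + k) mod t) = Some e\<close>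
        by cases simp_all
    qed
    ultimately show ?thesis
      unfolding scan by (intro image_eqI[of _ _ k]) simp_all
  qed
  show "set (result (scan_table v ?T)) \<subseteq> snd ` set ps"
  proof
    fix e assume "e \<in> set (result (scan_table v ?T))"
    then obtain k where k: "k < run_length ?T v" "e = the (?T ! ((v + k) mod t))"
      unfolding scan by blast
    then have "(v + k) mod t \<in> pos ` {..<length ps}"
      using run_length_occupied[OF s, of k v] assms unfolding occ[symmetric] by simp
    then show "e \<in> snd ` set ps"
      using k entry by auto
  qed
qed

lemma time_scan_table: "time (scan_table v T) = length (result (scan_table v T)) + 1"
  by (simp add: scan_table_def)

text \<open>
  An element stored in a full interval of slots that is preceded by an empty slot was hashed into that
  interval, since its probe sequence cannot have passed the empty slot.
\<close>

lemma full_interval_card: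
  assumes "linear_probed ps T" and "length T = t" and "n \<le> t"
    and "T ! (e mod t) = None"
    and "\<And>j. j < n \<Longrightarrow> T ! ((e + 1 + j) mod t) \<noteq> None"
  shows "n \<le> card {i. i < length ps \<and> fst (ps ! i) mod t \<in> (\<lambda>j. (e + 1 + j) mod t) ` {..<n}}"
proof (cases "n = 0")
  case False
  then have t: "0 < t" using assms(3) by simp
  obtain pos where inj: "inj_on pos {..<length ps}"
    and occ: "{s. s < length T \<and> T ! s \<noteq> None} = pos ` {..<length ps}"
    and "\<forall>i<length ps. T ! pos i = Some (snd (ps ! i))"
    and path: "\<forall>i<length ps. \<exists>k. pos i = (fst (ps ! i) + k) mod length T \<and>
               (\<forall>k'<k. T ! ((fst (ps ! i) + k') mod length T) \<noteq> None)"
    by (rule linear_probedE[OF assms(1)])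
  let ?I = "(\<lambda>j. (e + 1 + j) mod t) ` {..<n}"
  let ?H = "{i. i < length ps \<and> fst (ps ! i) mod t \<in> ?I}"
  have "inj_on (\<lambda>j. (e + 1 + j) mod t) {..<n}"
  proof (rule inj_onI)
    fix a b assume ab: "a \<in> {..<n}" "b \<in> {..<n}" "(e + 1 + a) mod t = (e + 1 + b) mod t"
    then have "(a + (e + 1)) mod t = (b + (e + 1)) mod t"
      by (simp add: ac_simps)
    then have "a mod t = b mod t"
      by (rule nat_mod_add_cancel)
    then show "a = b"
      using ab assms(3) by simp
  qed
  then have "n = card ?I"
    by (simp add: card_image)
  also have "?I \<subseteq> pos ` ?H"
  proof
    fix s assume "s \<in> ?I"
    then obtain j where j: "j < n" "s = (e + 1 + j) mod t"
      by auto
    then have "s \<in> pos ` {..<length ps}"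
      using assms(2) assms(5)[of j] t unfolding occ[symmetric] by simp
    then obtain i where i: "i < length ps" "s = pos i"
      by auto
    obtain k where k: "s = (fst (ps ! i) + k) mod t"
      "\<And>k'. k' < k \<Longrightarrow> T ! ((fst (ps ! i) + k') mod t) \<noteq> None"
      using path[rule_format, OF i(1)] i(2) assms(2) by auto
    have "k \<le> j"
    proof (rule ccontr)
      assume "\<not> k \<le> j"
      then obtain k' where k': "k = k' + (1 + j)"
        using that[of "k - (1 + j)"] by simp
      have "(fst (ps ! i) + k' + (1 + j)) mod t = (e + (1 + j)) mod t"
        using j(2) k(1) k' by (simp add: ac_simps)
      then have "(fst (ps ! i) + k') mod t = e mod t"
        by (rule nat_mod_add_cancel)
      then show False
        using k(2)[of k'] k' assms(4) by simp
    qed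
    then have "(fst (ps ! i) + k) mod t = (e + 1 + (j - k) + k) mod t"
      using j(2) k(1) by simp
    then have "fst (ps ! i) mod t = (e + 1 + (j - k)) mod t"
      by (rule nat_mod_add_cancel)
    then have "i \<in> ?H"
      using i(1) j(1) by auto
    then show "s \<in> pos ` ?H"
      using i(2) by blast
  qed
  then have "card ?I \<le> card (pos ` ?H)"
    by (intro card_mono) auto
  also have "\<dots> \<le> card ?H"
    by (intro card_image_le) auto
  finally show ?thesis .
qed simp

text \<open>The cyclic interval from d slots before v to l - 1 slots after it; \<open>t - d\<close>
  plays the role of -d modulo t.\<close>

definition window :: "nat \<Rightarrow> nat \<Rightarrow> nat \<Rightarrow> nat \<Rightarrow> nat set" where
  "window t v d l = (\<lambda>j. (v + (t - d) + j) mod t) ` {..<d + l}"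

lemma card_window_le: "card (window t v d l) \<le> d + l"
  unfolding window_def using card_image_le[of "{..<d + l}"] by simp

lemma window_subset: "0 < t \<Longrightarrow> window t v d l \<subseteq> {..<t}"
  by (auto simp: window_def)

text \<open>
  If the run from \<open>v\<close> has length at least \<open>l\<close>, extend it backwards by the \<open>d\<close> occupied slots that
  immediately precede \<open>v\<close>.
\<close>

lemma run_length_window:
  assumes "length ps < t" and "l \<le> run_length (fill t ps) v"
  shows "\<exists>d<t. d + l \<le> card {i. i < length ps \<and> fst (ps ! i) mod t \<in> window t v d l}"
proof -
  let ?T = "fill t ps"
  have lp: "linear_probed ps ?T"
    using assms by (simp add: linear_probed_fill)
  obtain s where s: "s < t" "?T ! s = None"
    using exists_empty_slot[OF lp] assms by auto
  then have s': "s < length ?T"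
    by simp
  \<comment> \<open>\<open>P d\<close> says that the slot d + 1 places before v, cyclically, is
    empty. The least such d is the number of occupied slots immediately before v, and
    \<open>e\<close> below is the empty slot in front of them.\<close>
  define P where "P d \<longleftrightarrow> d < t \<and> ?T ! ((v + (t - Suc d)) mod t) = None" for d
  define d where "d = (LEAST d. P d)"
  obtain k where k: "k < t" "(v + k) mod t = s"
    using mod_reachable[OF s(1)] by blast
  then have "P (t - Suc k)"
    using s by (simp add: P_def)
  then have "P d"
    unfolding d_def by (rule LeastI)
  have d_min: "\<not> P d'" if "d' < d" for d'
    using that unfolding d_def by (rule not_less_Least)
  define e where "e = v + (t - Suc d)"
  have d: "d < t" "?T ! (e mod t) = None"
    using \<open>P d\<close> by (auto simp: P_def e_def)
  have run: "?T ! ((e + 1 + j) mod t) \<noteq> None" if "j < d + l" for j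
  proof (cases "j < d")
    case True
    then have "e + 1 + j = v + (t - Suc (d - j - 1))"
      using d(1) by (simp add: e_def)
    then show ?thesis
      using d_min[of "d - j - 1"] True d(1) by (simp add: P_def)
  next
    case False
    then have "e + 1 + j = v + (j - d) + t"
      using d(1) by (simp add: e_def)
    then have "(e + 1 + j) mod t = (v + (j - d)) mod t"
      by simp
    then show ?thesis
      using run_length_occupied[OF s' s(2), of "j - d" v] that False assms(2) by simp
  qed
  \<comment> \<open>Otherwise the interval would wrap around: its element with index t - 1 is the
    slot of \<open>e\<close> again, which is empty.\<close>
  have "d + l \<le> t"
  proof (rule ccontr)
    assume "\<not> d + l \<le> t"
    then have "t - 1 < d + l" using d(1) by simp
    from run[OF this] have "?T ! ((e + t) mod t) \<noteq> None"
      using d(1) by simp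
    then show False
      using d(2) by simp
  qed
  from full_interval_card[OF lp _ this d(2) run]
  show ?thesis
    using d(1) unfolding window_def e_def by (intro exI[of _ d]) (simp add: Suc_diff_Suc)
qed


section \<open>Fully random hash functions\<close>

locale hashing =
  fixes \<sigma> L :: nat and V :: "nat set"
  assumes finite_V: "finite V" and V_nonempty: "V \<noteq> {}"
begin

abbreviation "U \<equiv> universe \<sigma> L"
abbreviation "H \<equiv> hash_functions \<sigma> L V"

definition mean :: "((str \<Rightarrow> nat) \<Rightarrow> real) \<Rightarrow> real" where
  "mean F = measure_pmf.expectation (random_hash \<sigma> L V) F"

lemma finite_universe: "finite U"
  unfolding universe_def by (rule finite_lists_length_le) simp

lemma finite_H: "finite H"
  unfolding hash_functions_def using finite_universe finite_V by (intro finite_PiE) auto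

lemma H_nonempty: "H \<noteq> {}"
  using V_nonempty by (simp add: hash_functions_def PiE_eq_empty_iff)

lemma card_H_pos: "0 < card H"
  using finite_H H_nonempty by (simp add: card_gt_0_iff)

lemma hash_in_V: "h \<in> H \<Longrightarrow> x \<in> U \<Longrightarrow> h x \<in> V"
  by (auto simp: hash_functions_def)

text \<open>There are only finitely many hash functions, so the expectation is an average, and the
  rules below are facts about finite sums without integrability conditions.\<close>

lemma mean_eq: "mean F = sum F H / card H"
  unfolding mean_def random_hash_def
  using finite_H H_nonempty by (rule integral_pmf_of_set[rotated])

lemma mean_mono: "(\<And>h. h \<in> H \<Longrightarrow> F h \<le> G h) \<Longrightarrow> mean F \<le> mean G"
  unfolding mean_eq by (intro divide_right_mono sum_mono) auto

lemma mean_cong: "(\<And>h. h \<in> H \<Longrightarrow> F h = G h) \<Longrightarrow> mean F = mean G"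
  unfolding mean_eq by (simp cong: sum.cong)

lemma mean_const [simp]: "mean (\<lambda>_. a) = a"
  unfolding mean_eq using card_H_pos by simp

lemma mean_add [simp]: "mean (\<lambda>h. F h + G h) = mean F + mean G"
  unfolding mean_eq by (simp add: sum.distrib add_divide_distrib)

lemma mean_cmult [simp]: "mean (\<lambda>h. a * F h) = a * mean F"
  unfolding mean_eq by (simp add: sum_distrib_left[symmetric])

lemma mean_sum: "mean (\<lambda>h. \<Sum>i\<in>A. F i h) = (\<Sum>i\<in>A. mean (F i))"
  unfolding mean_eq by (subst sum.swap) (simp add: sum_divide_distrib)

lemma mean_sum_list: "mean (\<lambda>h. \<Sum>i\<leftarrow>xs. F i h) = (\<Sum>i\<leftarrow>xs. mean (F i))"
  by (induction xs) simp_all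

text \<open>Independence of the hash values of different strings: expanding the product of the sums
  over \<open>V\<close> enumerates all functions from \<open>U\<close> to \<open>V\<close>.\<close>

lemma mean_prod:
  "mean (\<lambda>h. \<Prod>x\<in>U. f x (h x)) = (\<Prod>x\<in>U. sum (f x) V / card V)"
proof -
  have "(\<Sum>h\<in>H. \<Prod>x\<in>U. f x (h x)) = (\<Prod>x\<in>U. sum (f x) V)"
    unfolding hash_functions_def by (rule prod_sum_PiE[symmetric]) (simp_all add: finite_universe finite_V)
  moreover have "real (card H) = (\<Prod>x\<in>U. real (card V))"
    unfolding hash_functions_def by (simp add: card_PiE finite_universe)
  ultimately show ?thesis
    unfolding mean_eq by (simp only: prod_dividef)
qed

text \<open>
  Swapping the values outside \<open>A\<close> between two independent hash functions is an involution.
\<close>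

lemma mean_mix: "mean F = mean (\<lambda>h. mean (\<lambda>h'. F (\<lambda>x. if x \<in> A then h x else h' x)))"
proof -
  define mix :: "(str \<Rightarrow> nat) \<Rightarrow> (str \<Rightarrow> nat) \<Rightarrow> (str \<Rightarrow> nat)"
    where "mix h h' = (\<lambda>x. if x \<in> A then h x else h' x)" for h h'
  have mix_H: "mix h h' \<in> H" if "h \<in> H" "h' \<in> H" for h h'
    using that by (auto simp: mix_def hash_functions_def PiE_def extensional_def)
  have "(\<Sum>h\<in>H. \<Sum>h'\<in>H. F (mix h h')) = (\<Sum>p\<in>H \<times> H. F (mix (fst p) (snd p)))"
    by (simp add: sum.cartesian_product case_prod_unfold)
  also have "\<dots> = (\<Sum>p\<in>H \<times> H. F (fst p))"
    by (rule sum.reindex_bij_witness[where i = "\<lambda>(h, h'). (mix h h', mix h' h)"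
          and j = "\<lambda>(h, h'). (mix h h', mix h' h)"])
       (auto simp: mix_H, auto simp: mix_def fun_eq_iff)
  also have "\<dots> = card H * sum F H"
    using sum.cartesian_product[of "\<lambda>h _. F h" H H]
    by (simp add: case_prod_unfold sum_distrib_left)
  finally have "(\<Sum>h\<in>H. \<Sum>h'\<in>H. F (mix h h')) = card H * sum F H" .
  then show ?thesis
    using card_H_pos unfolding mean_eq mix_def[symmetric]
    by (simp add: sum_divide_distrib[symmetric])
qed

text \<open>A bound in the style of Wald's identity for a random list with random costs. The list
  depends only on hash values inside A, the costs only on those outside, so resampling the values
  outside A fixes the list while the costs are averaged. The set B confines the cost bound to
  elements that can occur.\<close>

lemma mean_sum_list_indep:
  assumes X: "\<And>h h'. (\<And>x. x \<in> A \<Longrightarrow> h x = h' x) \<Longrightarrow> X h = X h'"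
    and Y: "\<And>a h h'. a \<in> B \<Longrightarrow> (\<And>x. x \<notin> A \<Longrightarrow> h x = h' x) \<Longrightarrow> Y a h = Y a h'"
    and B: "\<And>h. h \<in> H \<Longrightarrow> set (X h) \<subseteq> B"
    and K: "\<And>a. a \<in> B \<Longrightarrow> mean (Y a) \<le> K"
  shows "mean (\<lambda>h. \<Sum>a\<leftarrow>X h. Y a h) \<le> K * mean (\<lambda>h. length (X h))"
proof -
  define mix :: "(str \<Rightarrow> nat) \<Rightarrow> (str \<Rightarrow> nat) \<Rightarrow> (str \<Rightarrow> nat)"
    where "mix h h' = (\<lambda>x. if x \<in> A then h x else h' x)" for h h'
  have "mean (\<lambda>h. \<Sum>a\<leftarrow>X h. Y a h)
      = mean (\<lambda>h. mean (\<lambda>h'. \<Sum>a\<leftarrow>X (mix h h'). Y a (mix h h')))"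
    unfolding mix_def by (rule mean_mix)
  also have "\<dots> = mean (\<lambda>h. mean (\<lambda>h'. \<Sum>a\<leftarrow>X h. Y a h'))"
  proof (intro mean_cong)
    fix h h' assume "h \<in> H" "h' \<in> H"
    have "X (mix h h') = X h"
      by (rule X) (simp add: mix_def)
    moreover have "Y a (mix h h') = Y a h'" if "a \<in> set (X h)" for a
      by (rule Y) (use that B[OF \<open>h \<in> H\<close>] in \<open>auto simp: mix_def\<close>)
    ultimately show "(\<Sum>a\<leftarrow>X (mix h h'). Y a (mix h h')) = (\<Sum>a\<leftarrow>X h. Y a h')"
      by (simp cong: map_cong)
  qed
  also have "\<dots> \<le> mean (\<lambda>h. K * length (X h))"
  proof (rule mean_mono)
    fix h assume h: "h \<in> H"
    have "(\<Sum>a\<leftarrow>X h. mean (Y a)) \<le> (\<Sum>a\<leftarrow>X h. K)"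
      by (rule sum_list_mono) (use K B[OF h] in auto)
    then show "mean (\<lambda>h'. \<Sum>a\<leftarrow>X h. Y a h') \<le> K * length (X h)"
      by (simp add: mean_sum_list sum_list_triv mult.commute)
  qed
  finally show ?thesis
    by simp
qed

text \<open>
  The position of the set \<open>I\<close> may depend on the hash value of \<open>q\<close>, since the keys differ from \<open>q\<close>.
\<close>

lemma mean_hits_le:
  assumes "q \<in> U" and "S \<subseteq> U - {q}" and "0 < t" and "near_uniform \<delta> V t" and "1 \<le> z" and "0 \<le> \<delta>"
    and I: "\<And>v. I v \<subseteq> {..<t}" "\<And>v. card (I v) \<le> n"
  shows "mean (\<lambda>h. \<Prod>\<kappa>\<in>S. if h \<kappa> mod t \<in> I (h q) then z else 1)
    \<le> exp ((z - 1) * (1 + \<delta>) * n * card S / t)"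
proof -
  define p where "p = (z - 1) * (1 + \<delta>) * n / t"
  define hit where "hit v u = (if u mod t \<in> I v then z else 1)" for v u
  \<comment> \<open>The factor at q is the indicator of h q = v. Summing over v thus splits the mean
    by the hash value of q, while every summand remains a product over all of \<open>U\<close>, as
    \<open>mean_prod\<close> requires.\<close>
  define f where "f v x u = (if x = q then of_bool (u = v) else if x \<in> S then hit v u else 1)"
    for v u x
  have card_V: "0 < real (card V)"
    using finite_V V_nonempty by (simp add: card_gt_0_iff)
  have hit_le: "sum (hit v) V / card V \<le> exp p" for v
  proof -
    have "finite (I v)"
      using I(1) by (rule finite_subset) simp
    have "{u \<in> V. u mod t \<in> I v} = (\<Union>s\<in>I v. {u \<in> V. u mod t = s})"
      by auto
    then have "card {u \<in> V. u mod t \<in> I v} \<le> (\<Sum>s\<in>I v. card {u \<in> V. u mod t = s})"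
      using card_UN_le[OF \<open>finite (I v)\<close>] by simp
    then have "real t * real (card {u \<in> V. u mod t \<in> I v})
        \<le> real t * (\<Sum>s\<in>I v. real (card {u \<in> V. u mod t = s}))"
      by (intro mult_left_mono) (simp_all flip: of_nat_sum)
    also have "\<dots> = (\<Sum>s\<in>I v. real t * real (card {u \<in> V. u mod t = s}))"
      by (rule sum_distrib_left)
    also have "\<dots> \<le> (\<Sum>s\<in>I v. (1 + \<delta>) * card V)"
      using assms(4) I(1) unfolding near_uniform_def by (intro sum_mono) auto
    also have "\<dots> = card (I v) * ((1 + \<delta>) * card V)"
      by simp
    also have "\<dots> \<le> n * ((1 + \<delta>) * card V)"
      using I(2)[of v] assms(6) by (intro mult_right_mono) auto
    finally have hits: "real (card {u \<in> V. u mod t \<in> I v}) \<le> n * (1 + \<delta>) / t * card V"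
      using assms(3) by (simp add: field_simps)
    \<comment> \<open>Since the factor is 1 + (z - 1) times an indicator, its mean is 1 + (z - 1)
      times the chance of a hit. That is at most 1 + p, and hence at most exp p.\<close>
    have "sum (hit v) V = (\<Sum>u\<in>V. 1 + (z - 1) * of_bool (u mod t \<in> I v))"
      by (intro sum.cong) (simp_all add: hit_def)
    also have "\<dots> = card V + (z - 1) * card {u \<in> V. u mod t \<in> I v}"
      using finite_V by (simp add: sum.distrib sum_distrib_left[symmetric] Int_def)
    also have "\<dots> \<le> card V + (z - 1) * (n * (1 + \<delta>) / t * card V)"
      using hits assms(5) by (intro add_left_mono mult_left_mono) auto
    also have "\<dots> = (1 + p) * card V"
      by (simp add: p_def algebra_simps)
    finally have "sum (hit v) V / card V \<le> 1 + p"
      using card_V by (simp add: pos_divide_le_eq)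
    then show ?thesis
      using exp_ge_add_one_self[of p] by linarith
  qed
  have "finite S"
    using assms(2) finite_universe by (meson finite_Diff finite_subset)
  have U: "U = insert q (S \<union> (U - S - {q}))"
    using assms(1,2) by auto
  have "mean (\<lambda>h. \<Prod>\<kappa>\<in>S. if h \<kappa> mod t \<in> I (h q) then z else 1)
      = mean (\<lambda>h. \<Sum>v\<in>V. \<Prod>x\<in>U. f v x (h x))"
  proof (rule mean_cong)
    fix h assume "h \<in> H"
    have "(\<Prod>x\<in>U. f v x (h x)) = of_bool (h q = v) * (\<Prod>\<kappa>\<in>S. hit v (h \<kappa>))" for v
    proof -
      have "(\<Prod>x\<in>U. f v x (h x)) = f v q (h q) * (\<Prod>x\<in>U - {q}. f v x (h x))"
        using finite_universe assms(1) by (rule prod.remove)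
      also have "(\<Prod>x\<in>U - {q}. f v x (h x)) = (\<Prod>\<kappa>\<in>S. hit v (h \<kappa>))"
        using finite_universe assms(2) by (intro prod.mono_neutral_cong_right) (auto simp: f_def)
      finally show ?thesis
        by (simp add: f_def)
    qed
    then have "(\<Sum>v\<in>V. \<Prod>x\<in>U. f v x (h x)) = (\<Sum>v\<in>V. if h q = v then \<Prod>\<kappa>\<in>S. hit v (h \<kappa>) else 0)"
      by (intro sum.cong) simp_all
    also have "\<dots> = (\<Prod>\<kappa>\<in>S. hit (h q) (h \<kappa>))"
      using hash_in_V[OF \<open>h \<in> H\<close> assms(1)] finite_V by simp
    finally show "(\<Prod>\<kappa>\<in>S. if h \<kappa> mod t \<in> I (h q) then z else 1) = (\<Sum>v\<in>V. \<Prod>x\<in>U. f v x (h x))"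
      by (simp add: hit_def)
  qed
  also have "\<dots> = (\<Sum>v\<in>V. \<Prod>x\<in>U. sum (f v x) V / card V)"
    by (simp only: mean_sum mean_prod)
  also have "\<dots> \<le> (\<Sum>v\<in>V. exp p ^ card S / card V)"
  proof (rule sum_mono)
    fix v assume "v \<in> V"
    have "(\<Prod>x\<in>U. sum (f v x) V / card V)
        = (sum (f v q) V / card V) * (\<Prod>x\<in>U - {q}. sum (f v x) V / card V)"
      using finite_universe assms(1) by (rule prod.remove)
    \<comment> \<open>Only u = v contributes at q, so this factor becomes 1 / \<open>card V\<close>,
      and the sum over v is an average of bounds that do not depend on v.\<close>
    also have "sum (f v q) V = 1"
      using \<open>v \<in> V\<close> finite_V by (simp add: f_def)
    also have "(\<Prod>x\<in>U - {q}. sum (f v x) V / card V) = (\<Prod>\<kappa>\<in>S. sum (hit v) V / card V)"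
      using finite_universe assms(2) card_V
      by (intro prod.mono_neutral_cong_right)
         (auto simp: f_def intro!: arg_cong[where f = "\<lambda>x. x / card V"] sum.cong)
    also have "\<dots> \<le> (\<Prod>\<kappa>\<in>S. exp p)"
      using hit_le assms(5) by (intro prod_mono) (auto simp: hit_def intro!: divide_nonneg_nonneg sum_nonneg)
    finally show "(\<Prod>x\<in>U. sum (f v x) V / card V) \<le> exp p ^ card S / card V"
      by (simp add: divide_right_mono)
  qed
  also have "\<dots> = exp p ^ card S"
    using card_V by simp
  also have "\<dots> = exp ((z - 1) * (1 + \<delta>) * n * card S / t)"
    by (simp add: p_def flip: exp_of_nat_mult)
  finally show ?thesis .
qed

end


section \<open>The expected length of a run\<close>

text \<open>Holds for each single h: every l up to the run length contributes at least 1 to the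
  right-hand side, through the extension d given by \<open>run_length_window\<close>. The string q
  is singled out because v will be its hash value.\<close>

lemma run_length_le_sum:
  assumes ps: "length ps < t" and ks: "distinct ks" "map fst ps = map h ks" and z: "(1::real) \<le> z"
  shows "real (run_length (fill t ps) v)
    \<le> (\<Sum>l=1..t. \<Sum>d<t.
        z * (\<Prod>\<kappa>\<in>set ks - {q}. if h \<kappa> mod t \<in> window t v d l then z else 1) / z ^ (d + l))"
    (is "_ \<le> (\<Sum>l=1..t. \<Sum>d<t. ?w d l)")
proof -
  let ?R = "run_length (fill t ps) v"
  have nonneg: "0 \<le> ?w d l" for d l
    using z by (intro divide_nonneg_nonneg mult_nonneg_nonneg prod_nonneg) auto
  have "1 \<le> (\<Sum>d<t. ?w d l)" if l: "l \<le> ?R" for l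
  proof -
    obtain d where d: "d < t"
      "d + l \<le> card {i. i < length ps \<and> fst (ps ! i) mod t \<in> window t v d l}"
      using run_length_window[OF ps l] by blast
    have len: "length ps = length ks"
      using ks(2) by (metis length_map)
    have nth: "fst (ps ! i) = h (ks ! i)" if "i < length ps" for i
      using ks(2) that len by (metis nth_map)
    let ?hits = "{\<kappa> \<in> set ks. h \<kappa> mod t \<in> window t v d l}"
    have "card {i. i < length ps \<and> fst (ps ! i) mod t \<in> window t v d l} = card ?hits"
    proof (rule bij_betw_same_card[of "(!) ks"], rule bij_betw_imageI)
      show "inj_on ((!) ks) {i. i < length ps \<and> fst (ps ! i) mod t \<in> window t v d l}"
        using ks(1) len by (auto simp: inj_on_def nth_eq_iff_index_eq)
      show "(!) ks ` {i. i < length ps \<and> fst (ps ! i) mod t \<in> window t v d l} = ?hits"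
        using len nth by (auto simp: in_set_conv_nth)
    qed
    then have "z ^ (d + l) \<le> z ^ card ?hits"
      using d(2) z by (intro power_increasing) auto
    also have "\<dots> = (\<Prod>\<kappa>\<in>set ks. if h \<kappa> mod t \<in> window t v d l then z else 1)"
      by (simp add: prod.If_cases Int_def)
    \<comment> \<open>If q is among the keys, its factor is at most z; otherwise nothing is removed,
      and multiplying by z \<ge> 1 does no harm.\<close>
    also have "\<dots> \<le> z * (\<Prod>\<kappa>\<in>set ks - {q}. if h \<kappa> mod t \<in> window t v d l then z else 1)"
    proof -
      let ?P = "\<Prod>\<kappa>\<in>set ks - {q}. if h \<kappa> mod t \<in> window t v d l then z else 1"
      have "0 \<le> ?P"
        using z by (intro prod_nonneg) auto
      then have "?P \<le> z * ?P"
        using mult_right_mono[OF z] by simp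
      then show ?thesis
        by (cases "q \<in> set ks") (auto simp: prod.remove)
    qed
    finally have "1 \<le> ?w d l"
      using z by (simp add: pos_le_divide_eq)
    also have "\<dots> \<le> (\<Sum>d<t. ?w d l)"
      using d(1) nonneg by (intro member_le_sum) auto
    finally show ?thesis .
  qed
  then have "(\<Sum>l=1..?R. 1) \<le> (\<Sum>l=1..?R. \<Sum>d<t. ?w d l)"
    by (intro sum_mono) auto
  \<comment> \<open>Extending the range to t makes it independent of h, so that the mean can be
    moved inside the sums.\<close>
  also have "\<dots> \<le> (\<Sum>l=1..t. \<Sum>d<t. ?w d l)"
  proof (rule sum_mono2)
    have lp: "linear_probed ps (fill t ps)"
      using ps by (simp add: linear_probed_fill)
    then obtain s where "s < length (fill t ps)" "fill t ps ! s = None"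
      using exists_empty_slot[OF lp] ps by auto
    then have "?R < t"
      using run_length_less[of s "fill t ps" v] by simp
    then show "{1..?R} \<subseteq> {1..t}"
      by auto
  qed (use nonneg in \<open>auto intro: sum_nonneg\<close>)
  finally show ?thesis
    by simp
qed

text \<open>The factor z = \<open>inverse \<beta>\<close> times the bounds of two geometric series
  with ratio \<beta> exp (1 - \<beta>), one over the backward extension d and one over the tail
  index l.\<close>

definition probe_bound :: "real \<Rightarrow> real" where
  "probe_bound \<beta> = inverse \<beta> / (1 - \<beta> * exp (1 - \<beta>))\<^sup>2"

text \<open>This is 1 + x < exp x at x = \<beta> - 1, strict because \<beta> \<noteq> 1. It turns a
  load below 1 into geometric decay.\<close>

lemma probe_rate_less_1: "\<beta> * exp (1 - \<beta>) < 1" if "0 < \<beta>" "\<beta> < 1" for \<beta> :: real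
proof -
  have "\<beta> < exp (\<beta> - 1)"
    using exp_minus_greater[of "1 - \<beta>"] that by simp
  then have "\<beta> * exp (1 - \<beta>) < exp (\<beta> - 1) * exp (1 - \<beta>)"
    by simp
  then show ?thesis
    by (simp flip: exp_add)
qed

lemma probe_bound_nonneg: "0 < \<beta> \<Longrightarrow> 0 \<le> probe_bound \<beta>"
  by (simp add: probe_bound_def)

context hashing
begin

text \<open>The keys and t are linked by upper bounds only, so that the bound applies both to
  finished tables and to those in which only a prefix has been inserted. Only the first components
  of \<open>ps h\<close> are prescribed, since the stored signatures vary with h. The string q may
  be one of the keys or not.\<close>

lemma mean_run_length_le:
  fixes \<alpha> \<delta> :: real
  assumes q: "q \<in> U" and ks: "distinct ks" "set ks \<subseteq> U"
    and t: "length ks < t" "length ks \<le> \<alpha> * t" "near_uniform \<delta> V t"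
    and \<alpha>: "0 < \<alpha>" "0 \<le> \<delta>" "\<alpha> * (1 + \<delta>) < 1"
    and ps: "\<And>h. h \<in> H \<Longrightarrow> map fst (ps h) = map h ks"
  shows "mean (\<lambda>h. run_length (fill t (ps h)) (h q)) \<le> probe_bound (\<alpha> * (1 + \<delta>))"
proof -
  define \<beta> where "\<beta> = \<alpha> * (1 + \<delta>)"
  have \<beta>: "0 < \<beta>" "\<beta> < 1"
    using \<alpha> by (simp_all add: \<beta>_def)
  \<comment> \<open>The minimiser of exp ((z - 1) \<beta>) / z; the minimum is the ratio
    \<open>\<rho>\<close> defined next.\<close>
  define z where "z = inverse \<beta>"
  have z: "1 \<le> z"
    using \<beta> by (simp add: z_def one_le_inverse)
  define \<rho> where "\<rho> = \<beta> * exp (1 - \<beta>)"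
  have \<rho>: "0 \<le> \<rho>" "\<rho> < 1"
    using \<beta> probe_rate_less_1 by (simp_all add: \<rho>_def)
  have "0 < t"
    using t(1) by simp
  define S where "S = set ks - {q}"
  let ?w = "\<lambda>d l h. \<Prod>\<kappa>\<in>S. if h \<kappa> mod t \<in> window t (h q) d l then z else 1"
  have w: "mean (?w d l) \<le> exp ((z - 1) * \<beta>) ^ (d + l)" for d l
  proof -
    have "mean (?w d l) \<le> exp ((z - 1) * (1 + \<delta>) * (d + l) * card S / t)"
      unfolding S_def using q ks(2) \<open>0 < t\<close> t(3) z \<alpha>(2)
      by (intro mean_hits_le window_subset card_window_le) auto
    also have "\<dots> \<le> exp ((z - 1) * (1 + \<delta>) * (d + l) * \<alpha>)"
    proof -
      have "card S \<le> length ks"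
        unfolding S_def by (meson card_Diff1_le card_length order_trans)
      then have "real (card S) \<le> \<alpha> * t"
        using t(2) by linarith
      then have "real (card S) / t \<le> \<alpha>"
        using \<open>0 < t\<close> by (simp add: pos_divide_le_eq)
      then have "(z - 1) * (1 + \<delta>) * (d + l) * (card S / t) \<le> (z - 1) * (1 + \<delta>) * (d + l) * \<alpha>"
        using z \<alpha>(2) by (intro mult_left_mono) auto
      then show ?thesis
        by simp
    qed
    also have "(z - 1) * (1 + \<delta>) * (d + l) * \<alpha> = (d + l) * ((z - 1) * \<beta>)"
      by (simp add: \<beta>_def)
    also have "exp (real (d + l) * ((z - 1) * \<beta>)) = exp ((z - 1) * \<beta>) ^ (d + l)"
      by (rule exp_of_nat_mult)
    finally show ?thesis .
  qed
  have "mean (\<lambda>h. run_length (fill t (ps h)) (h q))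
      \<le> mean (\<lambda>h. \<Sum>l=1..t. \<Sum>d<t. (z / z ^ (d + l)) * ?w d l h)"
  proof (rule mean_mono)
    fix h assume "h \<in> H"
    then have "length (ps h) < t"
      using ps t(1) by (metis length_map)
    from run_length_le_sum[OF this ks(1) ps[OF \<open>h \<in> H\<close>] z, of "h q" q]
    show "real (run_length (fill t (ps h)) (h q)) \<le> (\<Sum>l=1..t. \<Sum>d<t. (z / z ^ (d + l)) * ?w d l h)"
      by (simp add: S_def)
  qed
  also have "\<dots> = (\<Sum>l=1..t. \<Sum>d<t. (z / z ^ (d + l)) * mean (?w d l))"
    by (simp only: mean_sum mean_cmult)
  also have "\<dots> \<le> (\<Sum>l=1..t. \<Sum>d<t. z * (\<rho> ^ d * \<rho> ^ l))"
  proof (intro sum_mono)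
    fix l d
    have "(z / z ^ (d + l)) * mean (?w d l) \<le> (z / z ^ (d + l)) * exp ((z - 1) * \<beta>) ^ (d + l)"
      using w z by (intro mult_left_mono) auto
    also have "\<dots> = z * (exp ((z - 1) * \<beta>) / z) ^ (d + l)"
      by (simp add: power_divide)
    also have "exp ((z - 1) * \<beta>) / z = \<rho>"
      using \<beta> by (simp add: z_def \<rho>_def field_simps)
    finally show "(z / z ^ (d + l)) * mean (?w d l) \<le> z * (\<rho> ^ d * \<rho> ^ l)"
      by (simp add: power_add)
  qed
  also have "\<dots> = z * ((\<Sum>d<t. \<rho> ^ d) * (\<Sum>l=1..t. \<rho> ^ l))"
    by (simp add: sum_distrib_left sum_distrib_right)
  also have "\<dots> \<le> z * (1 / (1 - \<rho>) * (1 / (1 - \<rho>)))"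
  proof -
    have geom: "sum (\<lambda>d. \<rho> ^ d) A \<le> 1 / (1 - \<rho>)" if "finite A" for A
      using \<rho> that sum_le_suminf[of "\<lambda>d. \<rho> ^ d" A] by (simp add: suminf_geometric summable_geometric)
    show ?thesis
      using z \<rho> by (intro mult_left_mono mult_mono geom sum_nonneg) simp_all
  qed
  also have "\<dots> = probe_bound \<beta>"
    by (simp add: probe_bound_def z_def \<rho>_def power2_eq_square divide_inverse)
  finally show ?thesis
    by (simp add: \<beta>_def)
qed

end


section \<open>Edit distance\<close>

lemma edit_step_Nil: "(edit_step ^^ length x) x []"
proof (induction x)
  case (Cons a x)
  have "edit_step (a # x) x"
    unfolding edit_step_def by (rule exI[of _ "Del 0"]) simp
  then show ?case
    using relpowp_Suc_I2[OF _ Cons.IH] by simp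
qed simp

lemma edit_step_from_Nil: "(edit_step ^^ length y) [] y"
proof (induction y)
  case (Cons a y)
  have "edit_step y (a # y)"
    unfolding edit_step_def by (rule exI[of _ "Ins 0 a"]) simp
  then show ?case
    using Cons.IH by auto
qed simp

text \<open>\<open>edit_distance\<close> is a \<open>LEAST\<close>, so some edit sequence must be
  exhibited first: delete x letter by letter, then write y.\<close>

lemma edit_distance_le_1: "edit_distance x y \<le> 1 \<longleftrightarrow> x = y \<or> edit_step x y"
proof
  have "(edit_step ^^ (length x + length y)) x y"
    using edit_step_Nil edit_step_from_Nil by (auto simp: relpowp_add)
  then have "(edit_step ^^ edit_distance x y) x y"
    unfolding edit_distance_def by (rule LeastI)
  moreover assume "edit_distance x y \<le> 1"
  then have "edit_distance x y = 0 \<or> edit_distance x y = 1"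
    by linarith
  ultimately show "x = y \<or> edit_step x y"
    by auto
next
  assume "x = y \<or> edit_step x y"
  then have "(edit_step ^^ 0) x y \<or> (edit_step ^^ 1) x y"
    by (simp only: relpowp_0_I relpowp_1 simp_thms) auto
  then show "edit_distance x y \<le> 1"
    unfolding edit_distance_def
    by (elim disjE) (drule Least_le[where P = "\<lambda>k. (edit_step ^^ k) x y"], linarith)+
qed


section \<open>The tables as functions of the hash function\<close>

definition store_items :: "(nat \<Rightarrow> nat) \<Rightarrow> (str \<Rightarrow> nat) \<Rightarrow> str list \<Rightarrow> (nat \<times> nat \<times> nat) list" where
  "store_items sig h D = concat (map (\<lambda>x. map (\<lambda>j.
     (h (subst_key x j), x ! j, sig (h (subst_key x j)))) [0..<length x]) D)"

definition exact_items :: "(str \<Rightarrow> nat) \<Rightarrow> str list \<Rightarrow> nat \<Rightarrow> (nat \<times> str) list" where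
  "exact_items h D l = map (\<lambda>x. (h x, x)) (filter (\<lambda>x. length x = l) D)"

definition table :: "real \<Rightarrow> (nat \<times> 'e) list \<Rightarrow> 'e hash_table" where
  "table \<alpha> ps = fill (num_slots \<alpha> (length ps)) ps"

definition exact_tables :: "real \<Rightarrow> (str \<Rightarrow> nat) \<Rightarrow> str list \<Rightarrow> str hash_table list" where
  "exact_tables \<alpha> h D = map (\<lambda>l. table \<alpha> (exact_items h D l)) [0..<Suc (max_length D)]"

text \<open>The part of the insertion time that varies with the hash function. Each insertion probes
  a table that has its final number of slots but holds only the earlier entries.\<close>

definition collisions :: "real \<Rightarrow> (nat \<times> 'e) list \<Rightarrow> nat" where
  "collisions \<alpha> ps =
     (\<Sum>i<length ps. run_length (fill (num_slots \<alpha> (length ps)) (take i ps)) (fst (ps ! i)))"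

lemma result_build_table: "result (build_table \<alpha> ps) = table \<alpha> ps"
  by (simp add: build_table_def empty_table_def table_def fill_def)

lemma time_build_table:
  "time (build_table \<alpha> ps) = 1 + num_slots \<alpha> (length ps) + length ps + collisions \<alpha> ps"
  by (simp add: build_table_def empty_table_def time_insert_all collisions_def sum_Suc)

lemma num_slots_0 [simp]: "num_slots \<alpha> 0 = 0"
  by (simp add: num_slots_def)

lemma num_slots_greater: "k < num_slots \<alpha> k" if "0 < \<alpha>" "\<alpha> < 1" "0 < k"
proof -
  have "real k < real k / \<alpha>"
    using that by (simp add: pos_less_divide_eq)
  then have "int k < \<lceil>real k / \<alpha>\<rceil>"
    by linarith
  then show ?thesis
    by (simp add: num_slots_def)
qed

lemma num_slots_load: "real k \<le> \<alpha> * num_slots \<alpha> k" if "0 < \<alpha>"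
proof -
  have "real k / \<alpha> \<le> num_slots \<alpha> k"
    unfolding num_slots_def by (rule real_nat_ceiling_ge)
  then show ?thesis
    using that by (simp add: pos_divide_le_eq mult.commute)
qed

lemma num_slots_le: "real (num_slots \<alpha> k) \<le> k / \<alpha> + 1" if "0 < \<alpha>"
  using that unfolding num_slots_def by (simp add: of_nat_ceiling[of "real k / \<alpha>"])

text \<open>An empty collection gets a table without slots, for which \<open>run_length\<close>
  carries no meaning; hence the case distinction.\<close>

lemma scan_table_items:
  assumes "0 < \<alpha>" "\<alpha> < 1"
  shows length_scan_table_items: "length (result (scan_table v (table \<alpha> ps))) =
      (if ps = [] then 0 else run_length (table \<alpha> ps) v)"
    and scan_table_items_complete: "(v, e) \<in> set ps \<Longrightarrow> e \<in> set (result (scan_table v (table \<alpha> ps)))"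
    and scan_table_items_sound: "set (result (scan_table v (table \<alpha> ps))) \<subseteq> snd ` set ps"
proof -
  have lt: "length ps < num_slots \<alpha> (length ps)" if "ps \<noteq> []"
    using num_slots_greater[OF assms, of "length ps"] that by simp
  show "length (result (scan_table v (table \<alpha> ps))) = (if ps = [] then 0 else run_length (table \<alpha> ps) v)"
    using length_scan_fill[OF lt] by (simp add: table_def scan_table_def)
  show "e \<in> set (result (scan_table v (table \<alpha> ps)))" if "(v, e) \<in> set ps"
    unfolding table_def using that by (intro scan_fill_complete lt) auto
  show "set (result (scan_table v (table \<alpha> ps))) \<subseteq> snd ` set ps"
  proof (cases "ps = []")
    case False
    then show ?thesis
      unfolding table_def by (intro scan_fill_sound lt)
  qed (simp add: table_def scan_table_def)
qed

lemma length_store_items [simp]: "length (store_items sig h D) = total_length D"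
  by (simp add: store_items_def total_length_def length_concat comp_def)

lemma length_exact_items [simp]: "length (exact_items h D l) = length (filter (\<lambda>x. length x = l) D)"
  by (simp add: exact_items_def)

lemma length_exact_tables [simp]: "length (exact_tables \<alpha> h D) = Suc (max_length D)"
  by (simp add: exact_tables_def)

lemma length_le_max_length: "x \<in> set D \<Longrightarrow> length x \<le> max_length D"
  by (induction D) (auto simp: max_length_def)

lemma max_length_le_total_length: "max_length D \<le> total_length D"
  by (induction D) (auto simp: max_length_def total_length_def)

text \<open>Only the empty word adds nothing to the total length, and by distinctness it occurs at
  most once; this is the 1.\<close>

lemma length_le_total_length: "length D \<le> total_length D + 1" if "distinct D"
proof -
  have "length (filter (\<lambda>x. x \<noteq> []) D) \<le> total_length D"
    by (induction D) (auto simp: total_length_def neq_Nil_conv)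
  moreover have "length (filter (\<lambda>x. \<not> x \<noteq> []) D) \<le> 1"
  proof -
    have "length (filter (\<lambda>x. \<not> x \<noteq> []) D) = card (set (filter (\<lambda>x. \<not> x \<noteq> []) D))"
      using that by (intro distinct_card[symmetric] distinct_filter)
    also have "\<dots> \<le> card {[] :: nat list}"
      by (intro card_mono) auto
    finally show ?thesis
      by simp
  qed
  ultimately show ?thesis
    using sum_length_filter_compl[of "\<lambda>x. x \<noteq> []" D] by linarith
qed

lemma packed_words_mono: "packed_words \<sigma> w k \<le> packed_words \<sigma> w k'" if "k \<le> k'" "2 \<le> \<sigma>"
  unfolding packed_words_def using that
  by (intro nat_mono ceiling_mono divide_right_mono mult_right_mono) auto

lemma subst_key_wildcard: "j < length x \<Longrightarrow> wildcard \<in> set (subst_key x j)"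
  by (simp add: subst_key_def)


section \<open>The data structure for a fixed hash function\<close>

locale hashed_dictionary =
  fixes \<alpha> :: real and c \<sigma> w L :: nat and D :: "str list" and sig :: "nat \<Rightarrow> nat"
    and h :: "str \<Rightarrow> nat" and prep :: hasher
  assumes \<alpha>: "0 < \<alpha>" "\<alpha> < 1" and \<sigma>: "2 \<le> \<sigma>"
    and words: "\<And>x. x \<in> set D \<Longrightarrow> set x \<subseteq> {1..\<sigma>} \<and> length x \<le> L"
    and incremental: "incremental c \<sigma> L h prep"
begin

abbreviation "store \<equiv> table \<alpha> (store_items sig h D)"
abbreviation "exact \<equiv> exact_tables \<alpha> h D"

section \<open>Hashing and construction\<close>

lemma prep:
  assumes "set x \<subseteq> {1..\<sigma>}" "length x \<le> L"
  shows time_prep: "time (prep x) \<le> c * (length x + 1)"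
    and hash_prep: "fst (result (prep x)) = h x"
    and result_hev: "valid_edit e x \<Longrightarrow> apply_edit e x \<in> universe \<sigma> L \<Longrightarrow>
      result (snd (result (prep x)) e) = h (apply_edit e x)"
    and time_hev: "valid_edit e x \<Longrightarrow> apply_edit e x \<in> universe \<sigma> L \<Longrightarrow>
      time (snd (result (prep x)) e) \<le> c"
  using incremental assms unfolding incremental_def by (auto simp: case_prod_unfold)

lemma subst_key_universe: "x \<in> set D \<Longrightarrow> j < length x \<Longrightarrow> subst_key x j \<in> universe \<sigma> L"
  using words[of x] set_take_subset[of j x] set_drop_subset[of "Suc j" x]
  by (auto simp: subst_key_def universe_def)

lemma result_hash_word:
  assumes "x \<in> set D"
  shows "result (hash_word sig prep x) = ((h x, x), map (\<lambda>j.
     (h (subst_key x j), x ! j, sig (h (subst_key x j)))) [0..<length x])"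
  using words[OF assms] subst_key_universe[OF assms]
  by (auto simp: hash_word_def case_prod_unfold hash_prep result_hev subst_key_def)

lemma time_hash_word:
  assumes "x \<in> set D"
  shows "time (hash_word sig prep x) \<le> (2 * c + 2) * (length x + 1)"
proof -
  have "(\<Sum>j\<leftarrow>[0..<length x]. 1 + time (snd (result (prep x)) (Sub j \<phi>))) \<le> (\<Sum>j\<leftarrow>[0..<length x]. 1 + c)"
    using words[OF assms] subst_key_universe[OF assms]
    by (intro sum_list_mono) (auto simp: time_hev subst_key_def)
  then show ?thesis
    using time_prep[of x] words[OF assms]
    by (simp add: hash_word_def case_prod_unfold sum_list_triv algebra_simps)
qed

lemma hashed_items:
  shows "concat (map (\<lambda>x. snd (result (hash_word sig prep x))) D) = store_items sig h D"
    and "filter (\<lambda>p. length (snd p) = l) (map (\<lambda>x. fst (result (hash_word sig prep x))) D)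
      = exact_items h D l"
proof -
  show "concat (map (\<lambda>x. snd (result (hash_word sig prep x))) D) = store_items sig h D"
    unfolding store_items_def by (intro arg_cong[where f = concat] map_cong) (simp_all add: result_hash_word)
  have "map (\<lambda>x. fst (result (hash_word sig prep x))) D = map (\<lambda>x. (h x, x)) D"
    by (intro map_cong) (simp_all add: result_hash_word)
  then show "filter (\<lambda>p. length (snd p) = l) (map (\<lambda>x. fst (result (hash_word sig prep x))) D)
      = exact_items h D l"
    by (simp only: exact_items_def) (simp add: filter_map comp_def)
qed

lemma result_build: "result (build \<alpha> sig prep D) = (store, exact)"
  using hashed_items
  by (simp add: build_def comp_def result_build_table exact_tables_def del: upt_Suc)

text \<open>All terms except \<open>collisions\<close> are independent of the hash values. The 2 for
  each length pays for one round of the loop and for the constant part of creating a table.\<close>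

lemma time_build:
  "time (build \<alpha> sig prep D) \<le> (2 * c + 3) * (length D + total_length D)
    + (1 + length D + total_length D + max_length D)
    + (1 + num_slots \<alpha> (total_length D) + total_length D + collisions \<alpha> (store_items sig h D))
    + (\<Sum>l<Suc (max_length D). 2 + num_slots \<alpha> (length (exact_items h D l))
         + length (exact_items h D l) + collisions \<alpha> (exact_items h D l))"
proof -
  have "(\<Sum>x\<leftarrow>D. 1 + time (hash_word sig prep x)) \<le> (\<Sum>x\<leftarrow>D. (2 * c + 3) * (1 + length x))"
  proof (rule sum_list_mono)
    fix x assume "x \<in> set D"
    from time_hash_word[OF this]
    show "1 + time (hash_word sig prep x) \<le> (2 * c + 3) * (1 + length x)"
      by (simp add: algebra_simps)
  qed
  also have "\<dots> = (2 * c + 3) * (length D + total_length D)"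
    by (simp only: sum_list_const_mult sum_list_addf total_length_def) (simp add: sum_list_triv)
  finally show ?thesis
    using hashed_items
    by (simp add: build_def comp_def time_build_table interv_sum_list_conv_sum_set_nat
        atLeast0LessThan del: upt_Suc sum.lessThan_Suc)
qed

section \<open>Lookups in the exact dictionary\<close>

text \<open>Counted by the scan rather than by \<open>run_length\<close>, so that it is 0 for every
  length without dictionary words, including lengths beyond the last table.\<close>

definition probes :: "str \<Rightarrow> nat" where
  "probes y = length (result (scan_table (h y) (table \<alpha> (exact_items h D (length y)))))"

definition entries :: "str \<Rightarrow> (nat \<times> nat) list" where
  "entries \<kappa> = result (scan_table (h \<kappa>) store)"

lemma exact_nth: "length y < Suc (max_length D) \<Longrightarrow> exact ! length y = table \<alpha> (exact_items h D (length y))"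
  by (simp add: exact_tables_def del: upt_Suc)

lemma result_check: "result (check \<sigma> w exact (h y) y) = (if y \<in> set D then [y] else [])"
proof (cases "length y < length exact")
  case True
  let ?items = "exact_items h D (length y)"
  have "y \<in> set (result (scan_table (h y) (table \<alpha> ?items))) \<longleftrightarrow> y \<in> set D"
  proof
    assume "y \<in> set (result (scan_table (h y) (table \<alpha> ?items)))"
    then have "y \<in> snd ` set ?items"
      using scan_table_items_sound[OF \<alpha>] by (rule subsetD[rotated])
    then show "y \<in> set D"
      by (auto simp: exact_items_def)
  next
    assume "y \<in> set D"
    then have "(h y, y) \<in> set ?items"
      by (simp add: exact_items_def image_iff)
    then show "y \<in> set (result (scan_table (h y) (table \<alpha> ?items)))"
      by (rule scan_table_items_complete[OF \<alpha>])
  qed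
  moreover have "True \<in> set (map (\<lambda>y'. y' = y) ys) \<longleftrightarrow> y \<in> set ys" for ys
    by auto
  ultimately show ?thesis
    using True exact_nth[of y] by (simp add: check_def)
next
  case False
  then have "y \<notin> set D"
    using length_le_max_length by fastforce
  then show ?thesis
    using False by (simp add: check_def)
qed

text \<open>Each stored word met costs one step of the scan, one round of the loop and a comparison,
  which is 3 plus the packed length; the fixed cost is one less than that.\<close>

lemma time_check: "time (check \<sigma> w exact (h y) y) \<le> (3 + packed_words \<sigma> w (length y)) * (1 + probes y)"
proof (cases "length y < length exact")
  case True
  then show ?thesis
    using exact_nth[of y]
    by (simp add: check_def time_scan_table probes_def sum_list_triv algebra_simps)
next
  case False
  then show ?thesis
    by (simp add: check_def)
qed

section \<open>Candidates of a query and their cost\<close>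

context
  fixes q :: str
  assumes q: "set q \<subseteq> {1..\<sigma>}" "length q < L"
begin

abbreviation "hev \<equiv> snd (result (prep q))"
abbreviation "B \<equiv> 3 + packed_words \<sigma> w (length q + 1)"

text \<open>The strict inequality \<open>length q < L\<close> leaves room for an inserted
  letter.\<close>

lemma edit_universe:
  assumes "valid_edit e q" and "set_edit e \<subseteq> insert \<phi> {1..\<sigma>}"
  shows "apply_edit e q \<in> universe \<sigma> L"
proof -
  have "set (take k q) \<subseteq> insert \<phi> {1..\<sigma>}" "set (drop k q) \<subseteq> insert \<phi> {1..\<sigma>}" for k
    using q(1) set_take_subset[of k q] set_drop_subset[of k q] by blast+
  then show ?thesis
    using assms q(2) by (cases e) (simp_all add: universe_def)
qed

lemma length_apply_edit: "valid_edit e q \<Longrightarrow> length (apply_edit e q) \<le> length q + 1"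
  by (cases e) auto

lemma time_check_edit:
  assumes "valid_edit e q"
  shows "time (check \<sigma> w exact (h (apply_edit e q)) (apply_edit e q)) \<le> B * (1 + probes (apply_edit e q))"
  by (rule order_trans[OF time_check])
     (intro mult_right_mono add_left_mono packed_words_mono length_apply_edit assms \<sigma>, simp)

lemma try_edit:
  assumes "valid_edit e q" and "set_edit e \<subseteq> insert \<phi> {1..\<sigma>}"
  shows result_try_edit: "set (result (try_edit \<sigma> w exact q hev e)) = {apply_edit e q} \<inter> set D"
    and time_try_edit: "time (try_edit \<sigma> w exact q hev e) \<le> c + B * (1 + probes (apply_edit e q))"
proof -
  note u = edit_universe[OF assms]
  have hev: "result (hev e) = h (apply_edit e q)" "time (hev e) \<le> c"
    using result_hev[of q e] time_hev[of q e] q assms(1) u by simp_all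
  then show "set (result (try_edit \<sigma> w exact q hev e)) = {apply_edit e q} \<inter> set D"
    by (auto simp: try_edit_def result_check)
  show "time (try_edit \<sigma> w exact q hev e) \<le> c + B * (1 + probes (apply_edit e q))"
    unfolding try_edit_def time_bind hev(1)
    using hev(2) time_check_edit[OF assms(1)] by (rule add_mono)
qed

text \<open>A scan also collects entries of other keys that collided, but all of them are letters of
  dictionary words. So every candidate can be hashed by the evaluator, and it contains no
  wildcard.\<close>

lemma entries_sound:
  assumes "(a, s) \<in> set (entries \<kappa>)"
  shows "a \<in> {1..\<sigma>}"
proof -
  have "(a, s) \<in> snd ` set (store_items sig h D)"
  proof -
    have "snd ` set (store_items sig h D) \<supseteq> set (entries \<kappa>)"
      unfolding entries_def by (rule scan_table_items_sound[OF \<alpha>])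
    then show ?thesis
      using assms by (rule subsetD)
  qed
  then obtain x j where "x \<in> set D" "j < length x" "a = x ! j"
    by (auto simp: store_items_def)
  then show ?thesis
    using words[of x] by (auto simp: subset_iff)
qed

lemma entries_complete:
  assumes "y \<in> set D" "j < length y"
  shows "(y ! j, sig (h (subst_key y j))) \<in> set (entries (subst_key y j))"
  unfolding entries_def
  by (rule scan_table_items_complete[OF \<alpha>]) (use assms in \<open>force simp: store_items_def\<close>)

text \<open>Soundness comes from the exact dictionary: a collected letter with an accidentally
  matching signature only yields a candidate that is then looked up. Completeness holds because a
  word with some letter in place of the wildcard stored that letter under the very key that is
  queried.\<close>

lemma try_wildcard:
  assumes E: "E = Sub j \<and> j < length q \<or> E = Ins j \<and> j \<le> length q"
  shows result_try_wildcard: "set (result (try_wildcard \<sigma> w sig (store, exact) q hev E)) =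
      {y \<in> set D. \<exists>a. y = apply_edit (E a) q}" (is ?result)
    and time_try_wildcard: "time (try_wildcard \<sigma> w sig (store, exact) q hev E) \<le>
      c + 1 + (\<Sum>p\<leftarrow>entries (apply_edit (E \<phi>) q). c + 2 + B * (1 + probes (apply_edit (E (fst p)) q)))"
      (is ?time)
proof -
  let ?\<kappa> = "apply_edit (E \<phi>) q"
  have valid: "valid_edit (E a) q" for a
    using E by auto
  have letters: "set_edit (E a) \<subseteq> insert \<phi> {1..\<sigma>}" if "a \<in> insert \<phi> {1..\<sigma>}" for a
    using E that by auto
  have hev: "result (hev (E \<phi>)) = h ?\<kappa>" "time (hev (E \<phi>)) \<le> c"
    using result_hev[of q "E \<phi>"] time_hev[of q "E \<phi>"] q valid[of \<phi>]
      edit_universe[OF valid letters, of \<phi>] by simp_all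
  let ?f = "\<lambda>p. if snd p = sig (h ?\<kappa>) then try_edit \<sigma> w exact q hev (E (fst p)) else return_timed []"
  have result: "result (try_wildcard \<sigma> w sig (store, exact) q hev E) =
      concat (map (\<lambda>p. result (?f p)) (entries ?\<kappa>))"
    by (simp add: try_wildcard_def hev entries_def case_prod_unfold cong: if_cong)
  have time: "time (try_wildcard \<sigma> w sig (store, exact) q hev E) =
      time (hev (E \<phi>)) + (length (entries ?\<kappa>) + 1) + (\<Sum>p\<leftarrow>entries ?\<kappa>. 1 + time (?f p))"
    by (simp add: try_wildcard_def hev entries_def case_prod_unfold time_scan_table cong: if_cong)
  have in_alphabet: "fst p \<in> insert \<phi> {1..\<sigma>}" if "p \<in> set (entries \<kappa>)" for p \<kappa>
    using entries_sound[of "fst p" "snd p"] that by simp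
  have f: "set (result (?f p)) = (if snd p = sig (h ?\<kappa>) then {apply_edit (E (fst p)) q} \<inter> set D else {})"
     "time (?f p) \<le> c + B * (1 + probes (apply_edit (E (fst p)) q))" if "p \<in> set (entries ?\<kappa>)" for p
    using result_try_edit[OF valid letters[OF in_alphabet[OF that]]]
      time_try_edit[OF valid letters[OF in_alphabet[OF that]]] by simp_all
  show ?result
  proof (intro equalityI subsetI)
    fix y assume "y \<in> set (result (try_wildcard \<sigma> w sig (store, exact) q hev E))"
    then obtain p where p: "p \<in> set (entries ?\<kappa>)" "y \<in> set (result (?f p))"
      unfolding result by auto
    then have "y \<in> {apply_edit (E (fst p)) q} \<inter> set D"
      using f(1)[OF p(1)] by (metis empty_iff)
    then show "y \<in> {y \<in> set D. \<exists>a. y = apply_edit (E a) q}"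
      by auto
  next
    fix y assume "y \<in> {y \<in> set D. \<exists>a. y = apply_edit (E a) q}"
    then obtain a where y: "y \<in> set D" "y = apply_edit (E a) q"
      by blast
    \<comment> \<open>Masking position j of y gives the queried key in both cases; for an insertion,
      the masked letter is the one inserted into q.\<close>
    have j: "j < length y" "y ! j = a" "subst_key y j = ?\<kappa>"
      using E y(2) by (auto simp: subst_key_def nth_append min_def)
    let ?p = "(a, sig (h ?\<kappa>))"
    have p: "?p \<in> set (entries ?\<kappa>)"
      using entries_complete[OF y(1) j(1)] j by simp
    have "y \<in> set (result (?f ?p))"
      unfolding f(1)[OF p] using y by simp
    then show "y \<in> set (result (try_wildcard \<sigma> w sig (store, exact) q hev E))"
      unfolding result set_concat set_map image_image by (rule UN_I[OF p])
  qed
  \<comment> \<open>The scan costs one step for each entry. Moving these steps into the sum, next to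
    the one of the loop, gives the 2 in c + 2.\<close>
  have "(\<Sum>p\<leftarrow>entries ?\<kappa>. 1 + time (?f p)) + length (entries ?\<kappa>)
      = (\<Sum>p\<leftarrow>entries ?\<kappa>. (1 + time (?f p)) + 1)"
    by (simp only: sum_list_addf sum_list_triv) simp
  also have "\<dots> \<le> (\<Sum>p\<leftarrow>entries ?\<kappa>. c + 2 + B * (1 + probes (apply_edit (E (fst p)) q)))"
  proof (rule sum_list_mono)
    fix p assume "p \<in> set (entries ?\<kappa>)"
    from f(2)[OF this]
    show "1 + time (?f p) + 1 \<le> c + 2 + B * (1 + probes (apply_edit (E (fst p)) q))"
      by linarith
  qed
  finally show ?time
    unfolding time using hev(2) by linarith
qed

lemma result_query:
  "set (result (query \<sigma> w sig prep (store, exact) q)) = {y \<in> set D. edit_distance q y \<le> 1}"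
proof -
  have "set (result (query \<sigma> w sig prep (store, exact) q)) =
      ({q} \<inter> set D)
      \<union> (\<Union>j<length q. {apply_edit (Del j) q} \<inter> set D)
      \<union> (\<Union>j<length q. {y \<in> set D. \<exists>a. y = apply_edit (Sub j a) q})
      \<union> (\<Union>j<Suc (length q). {y \<in> set D. \<exists>a. y = apply_edit (Ins j a) q})"
  proof -
    have "set (result (check \<sigma> w exact (h q) q)) = {q} \<inter> set D"
      by (auto simp: result_check)
    moreover have "(\<Union>j<length q. set (result (try_edit \<sigma> w exact q hev (Del j)))) =
        (\<Union>j<length q. {apply_edit (Del j) q} \<inter> set D)"
      by (intro SUP_cong refl result_try_edit) auto
    moreover have "(\<Union>j<length q. set (result (try_wildcard \<sigma> w sig (store, exact) q hev (Sub j)))) =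
        (\<Union>j<length q. {y \<in> set D. \<exists>a. y = apply_edit (Sub j a) q})"
      by (intro SUP_cong refl result_try_wildcard) auto
    moreover have "(\<Union>j<Suc (length q). set (result (try_wildcard \<sigma> w sig (store, exact) q hev (Ins j)))) =
        (\<Union>j<Suc (length q). {y \<in> set D. \<exists>a. y = apply_edit (Ins j a) q})"
      by (intro SUP_cong refl result_try_wildcard) auto
    ultimately show ?thesis
      using q by (simp add: query_def case_prod_unfold hash_prep atLeast0LessThan Un_assoc del: upt_Suc)
  qed
  also have "\<dots> = {y \<in> set D. q = y \<or> edit_step q y}"
  proof -
    \<comment> \<open>The three disjuncts are the three kinds of candidates; any letter is allowed
      in the last two, since \<open>try_wildcard\<close> finds the dictionary words for all letters
      at once.\<close>
    have edit_step_iff: "edit_step q y \<longleftrightarrow> (\<exists>j<length q. y = apply_edit (Del j) q)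
        \<or> (\<exists>j<length q. \<exists>a. y = apply_edit (Sub j a) q)
        \<or> (\<exists>j<Suc (length q). \<exists>a. y = apply_edit (Ins j a) q)" (is "_ \<longleftrightarrow> ?R") for y
    proof
      assume "edit_step q y"
      then obtain e where "valid_edit e q" "y = apply_edit e q"
        unfolding edit_step_def by blast
      then show ?R
        by (cases e) (simp_all only: valid_edit.simps less_Suc_eq_le, blast+)
    next
      have edit: "edit_step q (apply_edit e q)" if "valid_edit e q" for e
        using that unfolding edit_step_def by blast
      assume ?R
      then show "edit_step q y"
        using edit[of "Del _"] edit[of "Sub _ _"] edit[of "Ins _ _"]
        by (elim disjE exE conjE) (simp_all only: valid_edit.simps less_Suc_eq_le)
    qed
    show ?thesis
    proof (rule set_eqI)
      fix y
      show "y \<in> ({q} \<inter> set D)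
      \<union> (\<Union>j<length q. {apply_edit (Del j) q} \<inter> set D)
      \<union> (\<Union>j<length q. {y \<in> set D. \<exists>a. y = apply_edit (Sub j a) q})
      \<union> (\<Union>j<Suc (length q). {y \<in> set D. \<exists>a. y = apply_edit (Ins j a) q}) \<longleftrightarrow>
        y \<in> {y \<in> set D. q = y \<or> edit_step q y}"
        unfolding mem_Collect_eq edit_step_iff
        by (cases "y \<in> set D"; cases "q = y") (simp_all del: apply_edit.simps add: Bex_def disj_assoc)
    qed
  qed
  finally show ?thesis
    by (simp only: edit_distance_le_1)
qed

definition wildcard_cost :: "(nat \<Rightarrow> nat edit) \<Rightarrow> nat" where
  "wildcard_cost E =
     (\<Sum>p\<leftarrow>entries (apply_edit (E \<phi>) q). c + 2 + B * (1 + probes (apply_edit (E (fst p)) q)))"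

lemma time_query:
  "time (query \<sigma> w sig prep (store, exact) q) \<le>
     (1 + c) * (length q + 1) + B * (1 + probes q)
     + (\<Sum>j<length q. 1 + c + B * (1 + probes (apply_edit (Del j) q)))
     + (\<Sum>j<length q. c + 2 + wildcard_cost (Sub j))
     + (\<Sum>j<Suc (length q). c + 2 + wildcard_cost (Ins j))"
proof -
  have "time (check \<sigma> w exact (h q) q) \<le> B * (1 + probes q)"
    by (rule order_trans[OF time_check])
       (intro mult_right_mono add_left_mono packed_words_mono \<sigma>, simp_all)
  moreover have "(\<Sum>j<length q. 1 + time (try_edit \<sigma> w exact q hev (Del j)))
      \<le> (\<Sum>j<length q. 1 + c + B * (1 + probes (apply_edit (Del j) q)))"
  proof (rule sum_mono)
    fix j assume "j \<in> {..<length q}"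
    then have "time (try_edit \<sigma> w exact q hev (Del j)) \<le> c + B * (1 + probes (apply_edit (Del j) q))"
      by (intro time_try_edit) auto
    then show "1 + time (try_edit \<sigma> w exact q hev (Del j)) \<le> 1 + c + B * (1 + probes (apply_edit (Del j) q))"
      by linarith
  qed
  moreover have W: "1 + time (try_wildcard \<sigma> w sig (store, exact) q hev E) \<le> c + 2 + wildcard_cost E"
    if "E = Sub j \<and> j < length q \<or> E = Ins j \<and> j \<le> length q" for E j
    using time_try_wildcard[OF that] unfolding wildcard_cost_def by linarith
  have "(\<Sum>j<length q. 1 + time (try_wildcard \<sigma> w sig (store, exact) q hev (Sub j)))
      \<le> (\<Sum>j<length q. c + 2 + wildcard_cost (Sub j))"
    by (rule sum_mono, rule W) auto
  moreover have "(\<Sum>j<Suc (length q). 1 + time (try_wildcard \<sigma> w sig (store, exact) q hev (Ins j)))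
      \<le> (\<Sum>j<Suc (length q). c + 2 + wildcard_cost (Ins j))"
    by (rule sum_mono, rule W) auto
  moreover have "time (query \<sigma> w sig prep (store, exact) q) = 1 + length q + time (prep q)
      + time (check \<sigma> w exact (h q) q)
      + (\<Sum>j<length q. 1 + time (try_edit \<sigma> w exact q hev (Del j)))
      + (\<Sum>j<length q. 1 + time (try_wildcard \<sigma> w sig (store, exact) q hev (Sub j)))
      + (\<Sum>j<Suc (length q). 1 + time (try_wildcard \<sigma> w sig (store, exact) q hev (Ins j)))"
    using q by (simp add: query_def case_prod_unfold hash_prep interv_sum_list_conv_sum_set_nat
        atLeast0LessThan del: upt_Suc sum.lessThan_Suc)
  moreover have "time (prep q) \<le> c * (length q + 1)"
    using time_prep[of q] q by simp
  moreover have "(1 + c) * (length q + 1) = 1 + length q + c * (length q + 1)"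
    by simp
  ultimately show ?thesis
    by linarith
qed

end

end


section \<open>The expected running times\<close>

lemma distinct_index_pairs: "distinct (concat (map (\<lambda>i. map (Pair i) [0..<f i]) [0..<n]))"
  by (induction n) (auto simp: distinct_map inj_on_def)

lemma sum_length_filter:
  fixes n :: nat
  shows "(\<And>x. x \<in> set xs \<Longrightarrow> f x < n) \<Longrightarrow> (\<Sum>l<n. length (filter (\<lambda>x. f x = l) xs)) = length xs"
proof (induction xs)
  case (Cons x xs)
  have "(\<Sum>l<n. length (filter (\<lambda>x. f x = l) (x # xs)))
      = (\<Sum>l<n. (if l = f x then 1 else 0) + length (filter (\<lambda>x. f x = l) xs))"
    by (intro sum.cong) auto
  moreover have "(\<Sum>l<n. if l = f x then 1 else 0 :: nat) = 1"
    using Cons.prems[of x] by simp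
  ultimately show ?case
    using Cons by (simp only: sum.distrib) simp
qed simp

definition subst_keys :: "str list \<Rightarrow> str list" where
  "subst_keys D = concat (map (\<lambda>x. map (subst_key x) [0..<length x]) D)"

lemma fst_store_items: "map fst (store_items sig h D) = map h (subst_keys D)"
  by (simp add: store_items_def subst_keys_def map_concat comp_def)

lemma fst_exact_items: "map fst (exact_items h D l) = map h (filter (\<lambda>x. length x = l) D)"
  by (simp add: exact_items_def comp_def)

text \<open>The list of keys is the image of an enumeration without repetition of the index pairs,
  so injectivity on index pairs becomes distinctness of the list.\<close>

lemma distinct_subst_keys:
  assumes "inj_on (\<lambda>(i, j). subst_key (D ! i) j) {(i, j). i < length D \<and> j < length (D ! i)}"
  shows "distinct (subst_keys D)"
proof -
  let ?idx = "concat (map (\<lambda>i. map (Pair i) [0..<length (D ! i)]) [0..<length D])"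
  have "subst_keys D = concat (map (\<lambda>i. map (subst_key (D ! i)) [0..<length (D ! i)]) [0..<length D])"
    unfolding subst_keys_def by (subst (1) map_nth[of D, symmetric]) (simp only: map_map comp_def)
  also have "\<dots> = map (\<lambda>(i, j). subst_key (D ! i) j) ?idx"
    by (simp add: map_concat comp_def)
  finally have "subst_keys D = map (\<lambda>(i, j). subst_key (D ! i) j) ?idx" .
  moreover have "set ?idx = {(i, j). i < length D \<and> j < length (D ! i)}"
    by auto
  ultimately show ?thesis
    using assms distinct_index_pairs by (simp only: distinct_map)
qed

locale random_dictionary = hashing \<sigma> L V for \<sigma> L :: nat and V :: "nat set" +
  fixes \<alpha> \<delta> :: real and c w :: nat and D :: "str list" and sig :: "nat \<Rightarrow> nat"
    and prep :: "(str \<Rightarrow> nat) \<Rightarrow> hasher"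
  assumes \<alpha>: "0 < \<alpha>" "\<alpha> < 1" and \<delta>: "0 \<le> \<delta>" "\<alpha> * (1 + \<delta>) < 1"
    and \<sigma>: "2 \<le> \<sigma>" and w: "0 < w"
    and distinct: "distinct D"
    and words: "\<And>x. x \<in> set D \<Longrightarrow> set x \<subseteq> {1..\<sigma>} \<and> length x \<le> L"
    and nonempty: "1 \<le> total_length D"
    and uniform: "\<And>t. t \<in> table_sizes \<alpha> D \<Longrightarrow> near_uniform \<delta> V t"
    and incremental: "\<And>h. h \<in> H \<Longrightarrow> incremental c \<sigma> L h (prep h)"
    and keys: "inj_on (\<lambda>(i, j). subst_key (D ! i) j) {(i, j). i < length D \<and> j < length (D ! i)}"
begin

abbreviation "store h \<equiv> table \<alpha> (store_items sig h D)"
abbreviation "exact h \<equiv> exact_tables \<alpha> h D"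

definition K :: real where
  "K = probe_bound (\<alpha> * (1 + \<delta>))"

lemma K_nonneg: "0 \<le> K"
  unfolding K_def using \<alpha> \<delta> by (intro probe_bound_nonneg) simp

lemma dictionary: "h \<in> H \<Longrightarrow> hashed_dictionary \<alpha> c \<sigma> L D h (prep h)"
  using \<alpha> \<sigma> words incremental by unfold_locales

section \<open>Expected cost of a scan and of filling a table\<close>

lemma mean_length_scan_le:
  assumes "\<kappa> \<in> U" "distinct ks" "set ks \<subseteq> U" "near_uniform \<delta> V (num_slots \<alpha> (length ks))"
    and ps: "\<And>h. map fst (ps h) = map h ks"
  shows "mean (\<lambda>h. length (result (scan_table (h \<kappa>) (table \<alpha> (ps h))))) \<le> K"
proof -
  have len: "length (ps h) = length ks" for h
    using ps[of h] by (metis length_map)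
  show ?thesis
  proof (cases "ks = []")
    case True
    then have "ps h = []" for h
      using len[of h] by simp
    then show ?thesis
      using K_nonneg by (simp add: length_scan_table_items[OF \<alpha>])
  next
    case False
    then have "ps h \<noteq> []" for h
      using len[of h] by auto
    then have "mean (\<lambda>h. length (result (scan_table (h \<kappa>) (table \<alpha> (ps h)))))
        = mean (\<lambda>h. run_length (table \<alpha> (ps h)) (h \<kappa>))"
      by (simp add: length_scan_table_items[OF \<alpha>])
    also have "\<dots> = mean (\<lambda>h. run_length (fill (num_slots \<alpha> (length ks)) (ps h)) (h \<kappa>))"
      by (simp add: table_def len)
    also have "\<dots> \<le> K"
      unfolding K_def using assms \<alpha> \<delta> False
      by (intro mean_run_length_le[where ks = ks]) (auto intro: num_slots_greater num_slots_load)
    finally show ?thesis .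
  qed
qed

text \<open>By linearity every insertion can be bounded on its own: the table it probes has all its
  slots but fewer keys, so its load is at most \<alpha> as well.\<close>

lemma mean_collisions_le:
  assumes "distinct ks" "set ks \<subseteq> U" "near_uniform \<delta> V (num_slots \<alpha> (length ks))"
    and ps: "\<And>h. map fst (ps h) = map h ks"
  shows "mean (\<lambda>h. collisions \<alpha> (ps h)) \<le> K * length ks"
proof -
  let ?t = "num_slots \<alpha> (length ks)"
  have len: "length (ps h) = length ks" for h
    using ps[of h] by (metis length_map)
  have fst: "fst (ps h ! i) = h (ks ! i)" if "i < length ks" for i h
    using ps[of h] that len by (metis nth_map)
  have "mean (\<lambda>h. collisions \<alpha> (ps h))
      = mean (\<lambda>h. \<Sum>i<length ks. real (run_length (fill ?t (take i (ps h))) (h (ks ! i))))"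
    by (simp add: collisions_def len fst)
  also have "\<dots> = (\<Sum>i<length ks. mean (\<lambda>h. run_length (fill ?t (take i (ps h))) (h (ks ! i))))"
    by (rule mean_sum)
  also have "\<dots> \<le> (\<Sum>i<length ks. K)"
  proof (rule sum_mono)
    fix i assume i: "i \<in> {..<length ks}"
    then have "length ks < ?t" "length ks \<le> \<alpha> * ?t"
      using \<alpha> by (auto intro: num_slots_greater num_slots_load)
    then show "mean (\<lambda>h. run_length (fill ?t (take i (ps h))) (h (ks ! i))) \<le> K"
      unfolding K_def using i assms(1-3) \<alpha> \<delta> set_take_subset[of i ks]
      by (intro mean_run_length_le[where ks = "take i ks" and ps = "\<lambda>h. take i (ps h)"])
         (auto simp: take_map[symmetric] ps)
  qed
  finally show ?thesis
    by (simp add: mult.commute)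
qed

lemma subst_keys_universe: "set (subst_keys D) \<subseteq> U"
  using H_nonempty hashed_dictionary.subst_key_universe[OF dictionary]
  by (auto simp: subst_keys_def)

lemma words_universe: "set D \<subseteq> U"
  using words by (auto simp: universe_def)

lemma length_subst_keys [simp]: "length (subst_keys D) = total_length D"
  by (simp add: subst_keys_def total_length_def length_concat comp_def)

lemma uniform_store: "near_uniform \<delta> V (num_slots \<alpha> (length (subst_keys D)))"
  by (rule uniform) (simp add: table_sizes_def)

lemma uniform_exact: "near_uniform \<delta> V (num_slots \<alpha> (length (filter (\<lambda>x. length x = l) D)))"
  by (rule uniform) (simp add: table_sizes_def)

section \<open>Expected construction time\<close>

theorem mean_time_build:
  "mean (\<lambda>h. time (build \<alpha> sig (prep h) D)) \<le> (6 * c + 25 + 3 / \<alpha> + 3 * K) * total_length D"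
proof -
  let ?n = "total_length D" and ?M = "max_length D" and ?d = "length D"
  let ?k = "\<lambda>l. length (filter (\<lambda>x. length x = l) D)"
  have "mean (\<lambda>h. time (build \<alpha> sig (prep h) D)) \<le> mean (\<lambda>h.
      (2 * c + 3) * (?d + ?n) + (1 + ?d + ?n + ?M) + (1 + num_slots \<alpha> ?n + ?n)
      + (real (collisions \<alpha> (store_items sig h D))
        + (\<Sum>l<Suc ?M. real (2 + num_slots \<alpha> (?k l) + ?k l) + real (collisions \<alpha> (exact_items h D l)))))"
  proof (rule mean_mono)
    fix h assume "h \<in> H"
    from of_nat_mono[OF hashed_dictionary.time_build[OF dictionary[OF this], of sig], where 'a = real]
    show "real (time (build \<alpha> sig (prep h) D)) \<le>
      (2 * c + 3) * (?d + ?n) + (1 + ?d + ?n + ?M) + (1 + num_slots \<alpha> ?n + ?n)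
      + (real (collisions \<alpha> (store_items sig h D))
        + (\<Sum>l<Suc ?M. real (2 + num_slots \<alpha> (?k l) + ?k l) + real (collisions \<alpha> (exact_items h D l))))"
      by (simp add: sum.distrib del: sum.lessThan_Suc)
  qed
  also have "\<dots> = (2 * c + 3) * (?d + ?n) + (1 + ?d + ?n + ?M) + (1 + num_slots \<alpha> ?n + ?n)
      + (mean (\<lambda>h. collisions \<alpha> (store_items sig h D))
        + (\<Sum>l<Suc ?M. real (2 + num_slots \<alpha> (?k l) + ?k l) + mean (\<lambda>h. collisions \<alpha> (exact_items h D l))))"
    by (simp only: mean_add mean_sum mean_const)
  also have "\<dots> \<le> (2 * c + 3) * (?d + ?n) + (1 + ?d + ?n + ?M) + (1 + (?n / \<alpha> + 1) + ?n)
      + (K * ?n + (\<Sum>l<Suc ?M. (2 + (?k l / \<alpha> + 1) + ?k l) + K * ?k l))"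
  proof -
    have "mean (\<lambda>h. collisions \<alpha> (store_items sig h D)) \<le> K * length (subst_keys D)"
      by (intro mean_collisions_le distinct_subst_keys keys subst_keys_universe uniform_store
          fst_store_items)
    moreover have "mean (\<lambda>h. collisions \<alpha> (exact_items h D l)) \<le> K * ?k l" for l
      using words_universe
      by (intro mean_collisions_le[where ks = "filter (\<lambda>x. length x = l) D"] distinct_filter distinct uniform_exact fst_exact_items) auto
    moreover have "real (2 + num_slots \<alpha> (?k l) + ?k l) \<le> 2 + (?k l / \<alpha> + 1) + ?k l" for l
      using num_slots_le[OF \<alpha>(1), of "?k l"] by simp
    moreover have "real (1 + num_slots \<alpha> ?n + ?n) \<le> 1 + (?n / \<alpha> + 1) + ?n"
      using num_slots_le[OF \<alpha>(1), of ?n] by simp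
    ultimately show ?thesis
      by (intro add_mono sum_mono order_refl) simp_all
  qed
  \<comment> \<open>Rounding up and setting up a table cost 3 for every length up to the maximum,
    even if no word has it. This stays linear because the maximal length is at most the total
    length.\<close>
  also have "(\<Sum>l<Suc ?M. (2 + (?k l / \<alpha> + 1) + ?k l) + K * ?k l)
      = 3 * (?M + 1) + (1 / \<alpha> + 1 + K) * (\<Sum>l<Suc ?M. real (?k l))"
    by (simp add: sum.distrib sum_distrib_left[symmetric] sum_divide_distrib[symmetric] algebra_simps
        del: sum.lessThan_Suc)
  also have "(\<Sum>l<Suc ?M. real (?k l)) = ?d"
    unfolding of_nat_sum[symmetric]
    by (subst sum_length_filter) (auto simp: less_Suc_eq_le length_le_max_length)
  finally have "mean (\<lambda>h. time (build \<alpha> sig (prep h) D)) \<le>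
      (2 * c + 3) * (?d + ?n) + (1 + ?d + ?n + ?M) + (1 + (?n / \<alpha> + 1) + ?n)
      + (K * ?n + (3 * (?M + 1) + (1 / \<alpha> + 1 + K) * ?d))" .
  \<comment> \<open>Every term becomes a multiple of the total length n by 1 \<le> n, by length D
    \<le> n + 1 \<le> 2 n and by the bound n on the maximal length.\<close>
  also have "\<dots> \<le> (2 * c + 3) * (2 * ?n + ?n) + (?n + 2 * ?n + ?n + ?n) + (?n + (?n / \<alpha> + ?n) + ?n)
      + (K * ?n + (3 * (?n + ?n) + (1 / \<alpha> + 1 + K) * (2 * ?n)))"
  proof -
    have "real ?d \<le> 2 * ?n" "real ?M \<le> ?n" "1 \<le> real ?n"
      using length_le_total_length[OF distinct] max_length_le_total_length[of D] nonempty by linarith+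
    moreover from this have "(1 / \<alpha> + 1 + K) * ?d \<le> (1 / \<alpha> + 1 + K) * (2 * ?n)"
      using K_nonneg \<alpha> by (intro mult_left_mono) auto
    moreover have "(2 * real c + 3) * (real ?d + real ?n) \<le> (2 * real c + 3) * (2 * real ?n + real ?n)"
      using \<open>real ?d \<le> 2 * ?n\<close> by (intro mult_left_mono) auto
    ultimately show ?thesis
      unfolding of_nat_add of_nat_mult of_nat_numeral of_nat_1
      by (intro add_mono) (assumption | simp)+
  qed
  also have "\<dots> = (6 * c + 25 + 3 / \<alpha> + 3 * K) * ?n"
    by (simp add: algebra_simps)
  finally show ?thesis .
qed

section \<open>Expected query time\<close>

definition probes :: "(str \<Rightarrow> nat) \<Rightarrow> str \<Rightarrow> nat" where
  "probes h = hashed_dictionary.probes \<alpha> D h"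

lemma mean_scan_exact_le:
  assumes "y \<in> U"
  shows "mean (\<lambda>h. length (result (scan_table (h y) (table \<alpha> (exact_items h D (length y)))))) \<le> K"
  using words_universe assms
  by (intro mean_length_scan_le[where ks = "filter (\<lambda>x. length x = length y) D"] distinct_filter distinct
      uniform_exact fst_exact_items) auto

lemma mean_probes_le: "mean (\<lambda>h. probes h y) \<le> K" if "y \<in> U"
proof -
  have "probes h y = length (result (scan_table (h y) (table \<alpha> (exact_items h D (length y)))))"
    if "h \<in> H" for h
    unfolding probes_def hashed_dictionary.probes_def[OF dictionary[OF that]] ..
  then show ?thesis
    using mean_scan_exact_le[OF that] by (simp cong: mean_cong)
qed

definition wildcard_cost :: "(str \<Rightarrow> nat) \<Rightarrow> str \<Rightarrow> (nat \<Rightarrow> nat edit) \<Rightarrow> nat" where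
  "wildcard_cost h = hashed_dictionary.wildcard_cost \<alpha> c \<sigma> w D sig h"

lemma mean_wildcard_cost_le:
  assumes q: "set q \<subseteq> {1..\<sigma>}" "length q < L"
    and E: "E = Sub j \<and> j < length q \<or> E = Ins j \<and> j \<le> length q"
  shows "mean (\<lambda>h. wildcard_cost h q E)
    \<le> K * (c + 2 + (3 + packed_words \<sigma> w (length q + 1)) * (1 + K))"
proof -
  let ?B = "3 + packed_words \<sigma> w (length q + 1)"
  let ?\<kappa> = "apply_edit (E \<phi>) q"
  define entries where "entries h = result (scan_table (h ?\<kappa>) (store h))" for h
  \<comment> \<open>The equation for \<open>probes\<close> is available only for h in
    \<open>H\<close>, whereas independence has to be shown for arbitrary functions; hence the scan
    is written out.\<close>
  define cost where "cost p h = real c + 2 + ?B * (1 + real (length (result (scan_table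
      (h (apply_edit (E (fst p)) q))
      (table \<alpha> (exact_items h D (length (apply_edit (E (fst p)) q))))))))" for p :: "nat \<times> nat" and h
  \<comment> \<open>\<open>edit_universe\<close> speaks of no hash function, but its locale fixes
    one; any element of \<open>H\<close> will do.\<close>
  obtain h\<^sub>0 where "h\<^sub>0 \<in> H"
    using H_nonempty by blast
  note edit_universe = hashed_dictionary.edit_universe[OF dictionary[OF \<open>h\<^sub>0 \<in> H\<close>] q]
  have valid: "valid_edit (E a) q" for a
    using E by auto
  have in_U: "apply_edit (E a) q \<in> U" if "a \<in> insert \<phi> {1..\<sigma>}" for a
    using E that by (intro edit_universe valid) auto
  have wild: "\<phi> \<in> set ?\<kappa>"
    using E by auto
  have plain: "\<phi> \<notin> set (apply_edit (E a) q)" if "a \<in> {1..\<sigma>}" for a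
  proof -
    have "\<phi> \<notin> set q"
      using q(1) by auto
    then have "\<phi> \<notin> set (take k q)" "\<phi> \<notin> set (drop k q)" for k
      using in_set_takeD[of \<phi> k q] in_set_dropD[of \<phi> k q] by blast+
    then show ?thesis
      using E that by auto
  qed
  have "mean (\<lambda>h. wildcard_cost h q E) = mean (\<lambda>h. \<Sum>p\<leftarrow>entries h. cost p h)"
  proof (rule mean_cong)
    fix h assume "h \<in> H"
    note d = dictionary[OF this]
    have of_nat_sum_list: "real (sum_list (map f xs)) = (\<Sum>x\<leftarrow>xs. real (f x))" for f and xs :: "(nat \<times> nat) list"
      by (induction xs) simp_all
    show "real (wildcard_cost h q E) = (\<Sum>p\<leftarrow>entries h. cost p h)"
      unfolding wildcard_cost_def hashed_dictionary.wildcard_cost_def[OF d q]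
        hashed_dictionary.entries_def[OF d] hashed_dictionary.probes_def[OF d] of_nat_sum_list
        entries_def cost_def
      by (simp add: algebra_simps)
  qed
  also have "\<dots> \<le> (c + 2 + ?B * (1 + K)) * mean (\<lambda>h. length (entries h))"
  \<comment> \<open>A consists of the strings with a wildcard. B is confined to letters of the
    alphabet, because a candidate with the wildcard in place of the letter would itself belong to
    A.\<close>
  proof (rule mean_sum_list_indep[where A = "{x. \<phi> \<in> set x}" and B = "{p. fst p \<in> {1..\<sigma>}}"])
    fix h h' :: "str \<Rightarrow> nat" assume eq: "\<And>x. x \<in> {x. \<phi> \<in> set x} \<Longrightarrow> h x = h' x"
    then have "store_items sig h D = store_items sig h' D"
      unfolding store_items_def
      by (intro arg_cong[where f = concat] map_cong refl) (simp add: subst_key_wildcard)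
    then show "entries h = entries h'"
      using eq wild by (simp add: entries_def)
  next
    fix p :: "nat \<times> nat" and h h' :: "str \<Rightarrow> nat"
    assume p: "p \<in> {p. fst p \<in> {1..\<sigma>}}" and eq: "\<And>x. x \<notin> {x. \<phi> \<in> set x} \<Longrightarrow> h x = h' x"
    have "exact_items h D l = exact_items h' D l" for l
      unfolding exact_items_def using words eq by (intro map_cong refl) fastforce
    moreover have "h (apply_edit (E (fst p)) q) = h' (apply_edit (E (fst p)) q)"
      using plain[of "fst p"] p eq by simp
    ultimately show "cost p h = cost p h'"
      by (simp only: cost_def)
  next
    fix h assume "h \<in> H"
    note d = dictionary[OF this]
    show "set (entries h) \<subseteq> {p. fst p \<in> {1..\<sigma>}}"
      using hashed_dictionary.entries_sound[OF d q, of _ _ sig ?\<kappa>]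
      unfolding hashed_dictionary.entries_def[OF d] entries_def by auto
  next
    fix p :: "nat \<times> nat" assume "p \<in> {p. fst p \<in> {1..\<sigma>}}"
    then have "apply_edit (E (fst p)) q \<in> U"
      by (intro in_U) auto
    from mean_scan_exact_le[OF this]
    have "?B * (1 + mean (\<lambda>h. length (result (scan_table (h (apply_edit (E (fst p)) q))
      (table \<alpha> (exact_items h D (length (apply_edit (E (fst p)) q)))))))) \<le> ?B * (1 + K)"
      by (intro mult_left_mono add_left_mono) auto
    then show "mean (cost p) \<le> c + 2 + ?B * (1 + K)"
      unfolding cost_def mean_add mean_const mean_cmult by simp
  qed
  also have "mean (\<lambda>h. length (entries h)) \<le> K"
    unfolding entries_def
    by (intro mean_length_scan_le[where ks = "subst_keys D"] in_U distinct_subst_keys keys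
        subst_keys_universe uniform_store fst_store_items) simp
  then have "(c + 2 + ?B * (1 + K)) * mean (\<lambda>h. length (entries h)) \<le> (c + 2 + ?B * (1 + K)) * K"
    using K_nonneg by (intro mult_left_mono) auto
  finally show ?thesis
    by (simp add: mult.commute)
qed

text \<open>For m \<ge> 1 the ceiling on the right is at least 1, which covers the 3 three times
  over; and m + 1 \<le> 2 m bounds the longer string by two further copies.\<close>

lemma packed_words_Suc_le:
  assumes "1 \<le> m"
  shows "3 + real (packed_words \<sigma> w (m + 1)) \<le> 5 * real_of_int \<lceil>real m * log 2 \<sigma> / w\<rceil>"
proof -
  define b where "b = log 2 \<sigma> / w"
  have "0 < b"
    using \<sigma> w by (simp add: b_def)
  then have pos: "0 < \<lceil>m * b\<rceil>"
    using assms by simp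
  have "real (m + 1) * b \<le> (2 * real m) * b"
    using assms \<open>0 < b\<close> by (intro mult_right_mono) auto
  also have "\<dots> \<le> of_int (2 * \<lceil>m * b\<rceil>)"
    using le_of_int_ceiling[of "m * b"] by simp
  finally have "\<lceil>real (m + 1) * b\<rceil> \<le> 2 * \<lceil>m * b\<rceil>"
    by (rule ceiling_le)
  moreover have "int (packed_words \<sigma> w (m + 1)) = \<lceil>real (m + 1) * b\<rceil>"
  proof -
    have "0 \<le> real (m + 1) * b"
      using \<open>0 < b\<close> by simp
    then have "0 \<le> \<lceil>real (m + 1) * b\<rceil>"
      using ceiling_mono[of 0 "real (m + 1) * b"] by simp
    moreover have "real (m + 1) * log 2 \<sigma> / w = real (m + 1) * b"
      by (simp add: b_def)
    ultimately show ?thesis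
      unfolding packed_words_def by (simp only: nat_0_le)
  qed
  ultimately have "3 + int (packed_words \<sigma> w (m + 1)) \<le> 5 * \<lceil>m * b\<rceil>"
    using pos by linarith
  then have "real_of_int (3 + int (packed_words \<sigma> w (m + 1))) \<le> real_of_int (5 * \<lceil>m * b\<rceil>)"
    by (simp only: of_int_le_iff)
  then show ?thesis
    by (simp add: b_def)
qed

theorem mean_time_query:
  assumes q: "q \<noteq> []" "set q \<subseteq> {1..\<sigma>}" "length q < L"
  shows "mean (\<lambda>h. time (query \<sigma> w sig (prep h) (result (build \<alpha> sig (prep h) D)) q))
    \<le> 2 * (2 * (1 + c) + 5 * (1 + K) + 2 * (c + 2) + 2 * (K * (c + 2 + 5 * (1 + K))))
        * (real (length q) * real_of_int \<lceil>real (length q) * log 2 \<sigma> / w\<rceil>)"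
proof -
  let ?m = "length q"
  let ?B = "3 + packed_words \<sigma> w (?m + 1)"
  define M where "M = real_of_int \<lceil>real ?m * log 2 \<sigma> / w\<rceil>"
  have m: "1 \<le> ?m"
    using q(1) by (cases q) auto
  have B: "?B \<le> 5 * M"
    using packed_words_Suc_le[OF m] by (simp add: M_def)
  have "0 < real ?m * log 2 \<sigma> / w"
    using m \<sigma> w by (intro divide_pos_pos mult_pos_pos) auto
  then have "0 < \<lceil>real ?m * log 2 \<sigma> / w\<rceil>"
    by (simp only: zero_less_ceiling)
  then have M: "1 \<le> M"
    unfolding M_def by linarith
  define W where "W = K * (c + 2 + ?B * (1 + K))"
  have "mean (\<lambda>h. time (query \<sigma> w sig (prep h) (result (build \<alpha> sig (prep h) D)) q))
     \<le> mean (\<lambda>h. real ((1 + c) * (?m + 1)) + ?B * (1 + real (probes h q))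
     + (\<Sum>j<?m. real (1 + c) + ?B * (1 + real (probes h (apply_edit (Del j) q))))
     + (\<Sum>j<?m. real (c + 2) + wildcard_cost h q (Sub j))
     + (\<Sum>j<Suc ?m. real (c + 2) + wildcard_cost h q (Ins j)))"
  proof (rule mean_mono)
    fix h assume "h \<in> H"
    note d = dictionary[OF this]
    from of_nat_mono[OF hashed_dictionary.time_query[OF d q(2,3), of w sig], where 'a = real]
    show "real (time (query \<sigma> w sig (prep h) (result (build \<alpha> sig (prep h) D)) q)) \<le>
       real ((1 + c) * (?m + 1)) + ?B * (1 + real (probes h q))
     + (\<Sum>j<?m. real (1 + c) + ?B * (1 + real (probes h (apply_edit (Del j) q))))
     + (\<Sum>j<?m. real (c + 2) + wildcard_cost h q (Sub j))
     + (\<Sum>j<Suc ?m. real (c + 2) + wildcard_cost h q (Ins j))"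
      unfolding hashed_dictionary.result_build[OF d] probes_def wildcard_cost_def
        of_nat_add of_nat_mult of_nat_sum of_nat_1 .
  qed
  also have "\<dots> = real ((1 + c) * (?m + 1)) + ?B * (1 + mean (\<lambda>h. probes h q))
     + (\<Sum>j<?m. real (1 + c) + ?B * (1 + mean (\<lambda>h. probes h (apply_edit (Del j) q))))
     + (\<Sum>j<?m. real (c + 2) + mean (\<lambda>h. wildcard_cost h q (Sub j)))
     + (\<Sum>j<Suc ?m. real (c + 2) + mean (\<lambda>h. wildcard_cost h q (Ins j)))"
    by (simp only: mean_add mean_sum mean_const mean_cmult)
  also have "\<dots> \<le> real ((1 + c) * (?m + 1)) + ?B * (1 + K)
     + (\<Sum>j<?m. real (1 + c) + ?B * (1 + K))
     + (\<Sum>j<?m. real (c + 2) + W) + (\<Sum>j<Suc ?m. real (c + 2) + W)"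
  proof -
    have "q \<in> U"
      using q by (auto simp: universe_def)
    moreover have "apply_edit (Del j) q \<in> U" for j
      using q set_take_subset[of j q] set_drop_subset[of "Suc j" q] by (auto simp: universe_def)
    ultimately show ?thesis
      unfolding W_def
      by (intro add_mono sum_mono mult_left_mono order_refl mean_probes_le
          mean_wildcard_cost_le[OF q(2,3)]) auto
  qed
  also have "\<dots> = (?m + 1) * (1 + c) + (?m + 1) * (?B * (1 + K)) + ?m * (1 + c)
      + (2 * ?m + 1) * (c + 2 + W)"
    by (simp add: algebra_simps)
  also have "\<dots> \<le> (?m + 1) * (1 + c) + (?m + 1) * (?B * (1 + K)) + (?m + 1) * (1 + c)
      + (2 * (?m + 1)) * (c + 2 + W)"
    using K_nonneg unfolding W_def by (intro add_mono mult_right_mono order_refl) auto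
  also have "\<dots> = (?m + 1) * (2 * (1 + c) + ?B * (1 + K) + 2 * (c + 2) + 2 * W)"
    by (simp add: algebra_simps)
  \<comment> \<open>The first factor uses m + 1 \<le> 2 m. In the second, terms without packed words
    are multiplied by M \<ge> 1, and those with them are bounded by 5 M; both need a nonempty
    query.\<close>
  also have "\<dots> \<le> (2 * ?m) * ((2 * (1 + c) + 5 * (1 + K) + 2 * (c + 2)
      + 2 * (K * (c + 2 + 5 * (1 + K)))) * M)"
  proof (rule mult_mono)
    have up: "x \<le> x * M" if "0 \<le> x" for x
      using mult_left_mono[OF M that] by simp
    have BK: "?B * (1 + K) \<le> 5 * (1 + K) * M"
      using mult_right_mono[OF B, of "1 + K"] K_nonneg by (simp add: algebra_simps)
    have "c + 2 + ?B * (1 + K) \<le> (c + 2 + 5 * (1 + K)) * M"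
      using up[of "real c + 2"] BK by (simp add: algebra_simps)
    then have "W \<le> K * ((c + 2 + 5 * (1 + K)) * M)"
      unfolding W_def using K_nonneg by (intro mult_left_mono) auto
    then show "2 * (1 + c) + ?B * (1 + K) + 2 * (c + 2) + 2 * W \<le> (2 * (1 + c) + 5 * (1 + K) + 2 * (c + 2)
      + 2 * (K * (c + 2 + 5 * (1 + K)))) * M"
      using up[of "2 * (1 + real c)"] up[of "2 * (real c + 2)"] BK by (simp add: algebra_simps)
  qed (use m K_nonneg in \<open>auto simp: W_def\<close>)
  finally show ?thesis
    by (simp add: M_def algebra_simps)
qed

end


theorem theorem2:
  fixes \<alpha> \<delta> c\<^sub>0 :: real and r c :: nat
  assumes "0 < \<alpha>" and "\<alpha> < 1"
    and "0 \<le> \<delta>" and "\<alpha> * (1 + \<delta>) < 1"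
    and "0 < c\<^sub>0"
  shows "\<exists>C>0. \<forall>(\<sigma>::nat) (w::nat) (L::nat) (V::nat set) (D::str list) (sig::nat \<Rightarrow> nat)
      (prep::(str \<Rightarrow> nat) \<Rightarrow> hasher).
    2 \<le> \<sigma> \<longrightarrow>
    distinct D \<longrightarrow>
    (\<forall>x\<in>set D. set x \<subseteq> {1..\<sigma>} \<and> length x \<le> L) \<longrightarrow>
    1 \<le> total_length D \<longrightarrow>
    0 < w \<longrightarrow>
    c\<^sub>0 * log 2 (real (total_length D)) \<le> real w \<longrightarrow>
    finite V \<longrightarrow>
    V \<noteq> {} \<longrightarrow>
    (\<forall>t\<in>table_sizes \<alpha> D. near_uniform \<delta> V t) \<longrightarrow>
    (\<forall>v\<in>V. sig v < 2 ^ r) \<longrightarrow>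
    (\<forall>h\<in>hash_functions \<sigma> L V. incremental c \<sigma> L h (prep h)) \<longrightarrow>
    inj_on (\<lambda>(i, j). subst_key (D ! i) j) {(i, j). i < length D \<and> j < length (D ! i)} \<longrightarrow>
    measure_pmf.expectation (random_hash \<sigma> L V)
        (\<lambda>h. real (time (build \<alpha> sig (prep h) D)))
      \<le> C * real (total_length D) \<and>
    (\<forall>q. q \<noteq> [] \<longrightarrow> set q \<subseteq> {1..\<sigma>} \<longrightarrow> length q < L \<longrightarrow>
      (\<forall>h\<in>hash_functions \<sigma> L V.
        set (result (query \<sigma> w sig (prep h) (result (build \<alpha> sig (prep h) D)) q))
          = {y \<in> set D. edit_distance q y \<le> 1}) \<and>
      measure_pmf.expectation (random_hash \<sigma> L V)
          (\<lambda>h. real (time (query \<sigma> w sig (prep h) (result (build \<alpha> sig (prep h) D)) q)))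
        \<le> C * (real (length q) * real_of_int \<lceil>real (length q) * log 2 (real \<sigma>) / real w\<rceil>))"
proof -
  \<comment> \<open>The value of \<open>K\<close> in every interpretation below. It is named
    beforehand because the constant must be chosen before the dictionary and the hash functions are
    fixed.\<close>
  define P where "P = probe_bound (\<alpha> * (1 + \<delta>))"
  have "0 \<le> P"
    unfolding P_def using assms by (intro probe_bound_nonneg) simp
  define C\<^sub>1 where "C\<^sub>1 = 6 * real c + 25 + 3 / \<alpha> + 3 * P"
  define C\<^sub>2 where "C\<^sub>2 = 2 * (2 * (1 + real c) + 5 * (1 + P) + 2 * (real c + 2)
    + 2 * (P * (real c + 2 + 5 * (1 + P))))"
  have "0 \<le> 3 / \<alpha>"
    using assms(1) by simp
  then have "0 < C\<^sub>1"
    using \<open>0 \<le> P\<close> unfolding C\<^sub>1_def by linarith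
  show ?thesis
  proof (intro exI[of _ "max C\<^sub>1 C\<^sub>2"] conjI allI impI)
    show "0 < max C\<^sub>1 C\<^sub>2"
      using \<open>0 < C\<^sub>1\<close> by simp
    fix \<sigma> w L :: nat and V :: "nat set" and D :: "str list" and sig :: "nat \<Rightarrow> nat"
      and prep :: "(str \<Rightarrow> nat) \<Rightarrow> hasher"
    assume "2 \<le> \<sigma>" "distinct D" "\<forall>x\<in>set D. set x \<subseteq> {1..\<sigma>} \<and> length x \<le> L"
      "1 \<le> total_length D" "0 < w" "finite V" "V \<noteq> {}"
      "\<forall>t\<in>table_sizes \<alpha> D. near_uniform \<delta> V t"
      "\<forall>h\<in>hash_functions \<sigma> L V. incremental c \<sigma> L h (prep h)"
      "inj_on (\<lambda>(i, j). subst_key (D ! i) j) {(i, j). i < length D \<and> j < length (D ! i)}"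
    then interpret random_dictionary \<sigma> L V \<alpha> \<delta> c w D sig prep
      using assms by unfold_locales auto
    have C: "C\<^sub>1 = 6 * c + 25 + 3 / \<alpha> + 3 * K"
      "C\<^sub>2 = 2 * (2 * (1 + c) + 5 * (1 + K) + 2 * (c + 2) + 2 * (K * (c + 2 + 5 * (1 + K))))"
      unfolding C\<^sub>1_def C\<^sub>2_def P_def K_def by simp_all
    have "mean (\<lambda>h. time (build \<alpha> sig (prep h) D)) \<le> C\<^sub>1 * total_length D"
      unfolding C by (rule mean_time_build)
    also have "\<dots> \<le> max C\<^sub>1 C\<^sub>2 * total_length D"
      by (intro mult_right_mono) auto
    finally show "measure_pmf.expectation (random_hash \<sigma> L V) (\<lambda>h. real (time (build \<alpha> sig (prep h) D)))
        \<le> max C\<^sub>1 C\<^sub>2 * real (total_length D)"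
      unfolding mean_def .
    fix q :: str assume q: "q \<noteq> []" "set q \<subseteq> {1..\<sigma>}" "length q < L"
    show "\<forall>h\<in>hash_functions \<sigma> L V.
        set (result (query \<sigma> w sig (prep h) (result (build \<alpha> sig (prep h) D)) q))
          = {y \<in> set D. edit_distance q y \<le> 1}"
      using hashed_dictionary.result_query[OF dictionary q(2,3)]
        hashed_dictionary.result_build[OF dictionary] by simp
    have "0 \<le> real (length q) * log 2 (real \<sigma>) / real w"
      using \<sigma> by simp
    then have nonneg: "0 \<le> real (length q) * real_of_int \<lceil>real (length q) * log 2 (real \<sigma>) / real w\<rceil>"
      using le_of_int_ceiling order_trans by (intro mult_nonneg_nonneg) fastforce+
    have "mean (\<lambda>h. time (query \<sigma> w sig (prep h) (result (build \<alpha> sig (prep h) D)) q))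
        \<le> C\<^sub>2 * (real (length q) * real_of_int \<lceil>real (length q) * log 2 (real \<sigma>) / real w\<rceil>)"
      unfolding C by (rule mean_time_query[OF q])
    also have "\<dots> \<le> max C\<^sub>1 C\<^sub>2 * (real (length q) * real_of_int \<lceil>real (length q) * log 2 (real \<sigma>) / real w\<rceil>)"
      using nonneg by (intro mult_right_mono) auto
    finally show "measure_pmf.expectation (random_hash \<sigma> L V)
          (\<lambda>h. real (time (query \<sigma> w sig (prep h) (result (build \<alpha> sig (prep h) D)) q)))
        \<le> max C\<^sub>1 C\<^sub>2 * (real (length q) * real_of_int \<lceil>real (length q) * log 2 (real \<sigma>) / real w\<rceil>)"
      unfolding mean_def .
  qed
qed

end
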